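(* Let $N$ be a positive integer and let $$R:=(0,1]\times[0,1]\times(0,1]\times[0,1]^{\times 8}\times(0,1]\subset\mathbb R^{12}.$$ For $J=(J_x,J_y,J_z,J_{xx},J_{xy},J_{xz},J_{yx},J_{yy},J_{yz},J_{zx},J_{zy},J_{zz})\in\mathbb R^{12}$ and $\alpha=\big((\alpha_j^k)_{1\le j\le N,\,k\in\{x,y,z\}},(\alpha_j^{kl})_{1\le j\le N-1,\,k,l\in\{x,y,z\}}\big)\in[-1,1]^{\times(12N-9)}$ define the Hamiltonian on $(\mathbb C^2)^{\otimes N}$ $$H_J(\alpha):=\sum_{j=1}^N\sum_{k\in\{x,y,z\}}J_k\alpha_j^k\hat\sigma_j^k+\sum_{j=1}^{N-1}\sum_{k,l\in\{x,y,z\}}J_{kl}\alpha_j^{kl}\hat\sigma_j^k\hat\sigma_{j+1}^l .$$ Then for any $J\in R$ (so that in particular $J_x,J_z,J_{zz}>0$), the set of all $\alpha\in[-1,1]^{\times(12N-9)}$ such that the spectrum of $H_J(\alpha)$ has degenerate gaps (i.e. does not have non-degenerate gaps) is of Lebesgue measure zero.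
   Context: $\hat\sigma_j^x,\hat\sigma_j^y,\hat\sigma_j^z$ are the Pauli matrices $\begin{pmatrix}0&1\\1&0\end{pmatrix},\begin{pmatrix}0&-i\\i&0\end{pmatrix},\begin{pmatrix}1&0\\0&-1\end{pmatrix}$ acting on the $j$-th tensor factor (spin-$1/2$ at position $j$) of $(\mathbb C^2)^{\otimes N}$, and as identity on the others. Non-degenerate gaps: the spectrum $\{E_j\}_{j=1}^{2^N}$ of a Hamiltonian (eigenvalues listed with multiplicity) has non-degenerate gaps if the differences $\{E_j-E_k\}_{j\ne k}$ are all distinct, i.e. for any $j\neq k$, $E_j-E_k=E_{j'}-E_{k'}$ implies $j=j'$ and $k=k'$. *)

theory Defs
  imports "HOL-Analysis.Lebesgue_Measure" "Jordan_Normal_Form.Char_Poly"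
begin

datatype axis = X | Y | Z

fun pauli :: "axis \<Rightarrow> complex mat" where
  "pauli X = mat_of_rows_list 2 [[0, 1], [1, 0]]"
| "pauli Y = mat_of_rows_list 2 [[0, - \<i>], [\<i>, 0]]"
| "pauli Z = mat_of_rows_list 2 [[1, 0], [0, - 1]]"

definition kronecker :: "complex mat \<Rightarrow> complex mat \<Rightarrow> complex mat" where
  "kronecker A B = mat (dim_row A * dim_row B) (dim_col A * dim_col B)
     (\<lambda>(r, c). A $$ (r div dim_row B, c div dim_col B) * B $$ (r mod dim_row B, c mod dim_col B))"

(* The tensor product M 1 \<otimes> ... \<otimes> M N. *)
definition tensor_factors :: "nat \<Rightarrow> (nat \<Rightarrow> complex mat) \<Rightarrow> complex mat" where
  "tensor_factors N M = foldr kronecker (map M [1..<Suc N]) (1\<^sub>m 1)"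

definition site_pauli :: "nat \<Rightarrow> nat \<Rightarrow> axis \<Rightarrow> complex mat" where
  "site_pauli N j k = tensor_factors N (\<lambda>i. if i = j then pauli k else 1\<^sub>m 2)"

(* The matrices form no comm_monoid_add, so finite sums of n x n matrices are taken entrywise. *)
definition mat_sum :: "nat \<Rightarrow> ('i \<Rightarrow> complex mat) \<Rightarrow> 'i set \<Rightarrow> complex mat" where
  "mat_sum n f A = mat n n (\<lambda>(r, c). \<Sum>i\<in>A. f i $$ (r, c))"

(* Names for the twelve coordinates J_k and J_kl of J. *)
datatype coupling = Single axis | Pair axis axis

(* Names for the coordinates of alpha: Site j k for alpha_j^k and Bond j k l for alpha_j^kl. *)
datatype coeff = Site nat axis | Bond nat axis axis

definition coeff_index :: "nat \<Rightarrow> coeff set" where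
  "coeff_index N =
     {Site j k | j k. j \<in> {1..N}} \<union> {Bond j k l | j k l. j \<in> {1..N - 1}}"

definition coeff_cube :: "nat \<Rightarrow> (coeff \<Rightarrow> real) set" where
  "coeff_cube N = (\<Pi>\<^sub>E i\<in>coeff_index N. {-1..1})"

definition coupling_region :: "(coupling \<Rightarrow> real) set" where
  "coupling_region = {J.
     J (Single X) \<in> {0<..1} \<and> J (Single Y) \<in> {0..1} \<and> J (Single Z) \<in> {0<..1} \<and>
     (\<forall>k l. (k, l) \<noteq> (Z, Z) \<longrightarrow> J (Pair k l) \<in> {0..1}) \<and>
     J (Pair Z Z) \<in> {0<..1}}"

definition hamiltonian :: "nat \<Rightarrow> (coupling \<Rightarrow> real) \<Rightarrow> (coeff \<Rightarrow> real) \<Rightarrow> complex mat" where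
  "hamiltonian N J \<alpha> =
     mat_sum (2 ^ N)
       (\<lambda>(j, k). complex_of_real (J (Single k) * \<alpha> (Site j k)) \<cdot>\<^sub>m site_pauli N j k)
       ({1..N} \<times> {X, Y, Z}) +
     mat_sum (2 ^ N)
       (\<lambda>(j, k, l). complex_of_real (J (Pair k l) * \<alpha> (Bond j k l)) \<cdot>\<^sub>m
          (site_pauli N j k * site_pauli N (j + 1) l))
       ({1..N - 1} \<times> {X, Y, Z} \<times> {X, Y, Z})"

(* es lists the eigenvalues of A with multiplicity, in some order. *)
definition lists_spectrum :: "complex mat \<Rightarrow> complex list \<Rightarrow> bool" where
  "lists_spectrum A es \<longleftrightarrow> char_poly A = (\<Prod>e\<leftarrow>es. [:- e, 1:])"

definition nondegenerate_gaps_list :: "complex list \<Rightarrow> bool" where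
  "nondegenerate_gaps_list es \<longleftrightarrow>
     (\<forall>j k j' k'. j < length es \<longrightarrow> k < length es \<longrightarrow> j' < length es \<longrightarrow> k' < length es \<longrightarrow>
        j \<noteq> k \<longrightarrow> es ! j - es ! k = es ! j' - es ! k' \<longrightarrow> j = j' \<and> k = k')"

(* The order of the listing is immaterial: see nondegenerate_gaps_iff below. *)
definition nondegenerate_gaps :: "complex mat \<Rightarrow> bool" where
  "nondegenerate_gaps A \<longleftrightarrow> (\<exists>es. lists_spectrum A es \<and> nondegenerate_gaps_list es)"

lemma nondegenerate_gaps_list_inj_on:
  "nondegenerate_gaps_list es \<longleftrightarrow>
     inj_on (\<lambda>(j, k). es ! j - es ! k) {(j, k). j < length es \<and> k < length es \<and> j \<noteq> k}"
  (is "?L \<longleftrightarrow> ?R")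
proof
  assume ?L
  then show ?R
    unfolding nondegenerate_gaps_list_def inj_on_def by auto
next
  assume R: ?R
  have inj: "j = j' \<and> k = k'"
    if "j < length es" "k < length es" "j \<noteq> k" "j' < length es" "k' < length es" "j' \<noteq> k'"
      "es ! j - es ! k = es ! j' - es ! k'" for j k j' k'
    using inj_onD[OF R, of "(j, k)" "(j', k')"] that by auto
  show ?L
    unfolding nondegenerate_gaps_list_def
  proof (intro allI impI)
    fix j k j' k'
    assume *: "j < length es" "k < length es" "j' < length es" "k' < length es" "j \<noteq> k"
      "es ! j - es ! k = es ! j' - es ! k'"
    show "j = j' \<and> k = k'"
    proof (cases "j' = k'")
      case True
      then have "es ! j - es ! k = es ! k - es ! j" using * by auto
      then show ?thesis using inj[of j k k j] * by blast
    next
      case False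
      then show ?thesis using inj * by blast
    qed
  qed
qed

lemma nondegenerate_gaps_list_mset:
  assumes "mset es = mset fs" "nondegenerate_gaps_list es"
  shows "nondegenerate_gaps_list fs"
proof -
  have len: "length es = length fs" using assms(1) by (rule mset_eq_length)
  obtain p where p: "p permutes {..<length es}" "permute_list p es = fs"
    using mset_eq_permutation[OF assms(1)[symmetric]] len by metis
  have fs: "fs ! i = es ! p i" if "i < length es" for i
    using p that by (metis permute_list_nth)
  have lt: "p i < length es" if "i < length es" for i
    using permutes_in_image[OF p(1)] that by blast
  have inj: "p i = p j \<longleftrightarrow> i = j" for i j
    using permutes_inj[OF p(1)] by (auto dest: injD)
  show ?thesis
    using assms(2) unfolding nondegenerate_gaps_list_def len[symmetric]
    by (metis fs lt inj)
qed

lemma lists_spectrum_exists: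
  assumes "A \<in> carrier_mat n n"
  shows "\<exists>es. lists_spectrum A es \<and> length es = n"
  using char_poly_factorized[OF assms] unfolding lists_spectrum_def by blast

lemma lists_spectrum_unique:
  assumes "lists_spectrum A es" "lists_spectrum A fs"
  shows "mset es = mset fs"
proof (rule multiset_eqI)
  fix x
  have order_prod: "order x (\<Prod>e\<leftarrow>gs. [:- e, 1:]) = count (mset gs) x" for gs :: "complex list"
  proof (induction gs)
    case Nil
    then show ?case by (simp add: order_1_eq_0)
  next
    case (Cons g gs)
    have "(\<Prod>e\<leftarrow>g # gs. [:- e, 1:]) \<noteq> (0 :: complex poly)"
      unfolding prod_list_zero_iff by auto
    then have "order x (\<Prod>e\<leftarrow>g # gs. [:- e, 1:]) = order x [:- g, 1:] + order x (\<Prod>e\<leftarrow>gs. [:- e, 1:])"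
      unfolding list.map prod_list.Cons by (rule order_mult)
    also have "\<dots> = count (mset (g # gs)) x"
      unfolding Cons.IH order_linear' by simp
    finally show ?case .
  qed
  show "count (mset es) x = count (mset fs) x"
    using assms unfolding lists_spectrum_def by (metis order_prod)
qed

lemma nondegenerate_gaps_iff:
  assumes "lists_spectrum A es"
  shows "nondegenerate_gaps A \<longleftrightarrow> nondegenerate_gaps_list es"
  using assms lists_spectrum_unique nondegenerate_gaps_list_mset
  unfolding nondegenerate_gaps_def by blast

lemma UNIV_axis: "(UNIV :: axis set) = {X, Y, Z}"
  using axis.exhaust by blast

lemma coeff_index_alt:
  "coeff_index N = (\<lambda>(j, k). Site j k) ` ({1..N} \<times> {X, Y, Z}) \<union>
     (\<lambda>(j, k, l). Bond j k l) ` ({1..N - 1} \<times> {X, Y, Z} \<times> {X, Y, Z})"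
  unfolding coeff_index_def UNIV_axis[symmetric] by (auto simp: image_iff)

lemma finite_coeff_index: "finite (coeff_index N)"
  unfolding coeff_index_alt by simp

lemma card_coeff_index:
  assumes "N \<ge> 1"
  shows "card (coeff_index N) = 12 * N - 9"
proof -
  have "card ((\<lambda>(j, k). Site j k) ` ({1..N} \<times> {X, Y, Z})) = 3 * N"
    by (subst card_image) (auto simp: inj_on_def card_cartesian_product)
  moreover have "card ((\<lambda>(j, k, l). Bond j k l) ` ({1..N - 1} \<times> {X, Y, Z} \<times> {X, Y, Z})) = 9 * (N - 1)"
    by (subst card_image) (auto simp: inj_on_def card_cartesian_product)
  ultimately show ?thesis
    unfolding coeff_index_alt using assms
    by (subst card_Un_disjoint) auto
qed

lemma tensor_factors_carrier:
  assumes "\<And>i. M i \<in> carrier_mat 2 2"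
  shows "tensor_factors N M \<in> carrier_mat (2 ^ N) (2 ^ N)"
proof -
  have "foldr kronecker (map M is) (1\<^sub>m 1) \<in> carrier_mat (2 ^ length is) (2 ^ length is)" for "is"
  proof (induction "is")
    case (Cons i "is")
    then show ?case using assms[of i] by (auto simp: kronecker_def)
  qed simp
  from this[of "[1..<Suc N]"] show ?thesis by (simp add: tensor_factors_def del: upt_Suc)
qed

lemma site_pauli_carrier: "site_pauli N j k \<in> carrier_mat (2 ^ N) (2 ^ N)"
proof -
  have "pauli k \<in> carrier_mat 2 2"
    by (cases k) (auto simp: mat_of_rows_list_def)
  then show ?thesis
    unfolding site_pauli_def by (intro tensor_factors_carrier) auto
qed

lemma hamiltonian_carrier: "hamiltonian N J \<alpha> \<in> carrier_mat (2 ^ N) (2 ^ N)"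
  unfolding hamiltonian_def mat_sum_def by simp

end

(* Listed over the pairs j /= k, the gaps E_j - E_k have power sums that are polynomial in the
   traces of powers of H, hence polynomial in alpha. The determinant D of the Hankel matrix of these
   power sums is the square of a Vandermonde determinant, so the gaps are pairwise distinct iff
   D /= 0. The zero set of a polynomial that does not vanish identically is null by Fubini, so it
   remains to find one alpha with D /= 0.

   Use only the couplings X, Z, ZZ and induct on N with the stronger claim that some H and some
   beta /= beta' have all gaps of H + beta Z_1 and H + beta' Z_1 together pairwise distinct. By
   genericity the four matrices H + k e Z_1, k in {3,-3,4,-4}, are then pairwise in the same relation
   (after a shift of H by a multiple of Z_1). Put a new spin in front, coupled by c Z Z_1 with
   c = 5 e, in a field s (12 X + b Z), b = 9 or b = 16, and let s tend to infinity: the new spin aligns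
   with its field, of size r = 15 s or r = 20 s, and the spectrum splits into r + spec (H + (b s / r) c Z_1)
   and -r + spec (H - (b s / r) c Z_1), up to o(1). So for large s all gaps are pairwise distinct. *)

theory Submission
  imports Defs "Jordan_Normal_Form.Schur_Decomposition"
begin

section \<open>Zero sets of polynomials\<close>

text \<open>Being polynomial in each variable separately is all that the Fubini argument needs.\<close>

definition separately_polynomial :: "'i set \<Rightarrow> (('i \<Rightarrow> real) \<Rightarrow> complex) \<Rightarrow> bool" where
  "separately_polynomial I F \<longleftrightarrow>
     F \<in> borel_measurable (\<Pi>\<^sub>M i\<in>I. lborel) \<and>
     (\<forall>x. \<forall>i\<in>I. \<exists>p. \<forall>t. F (x(i := t)) = poly p (complex_of_real t))"

lemma separately_polynomial_const: "separately_polynomial I (\<lambda>x. c)"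
  unfolding separately_polynomial_def by (auto intro: exI[of _ "[:c:]"])

lemma separately_polynomial_proj:
  assumes "i \<in> I"
  shows "separately_polynomial I (\<lambda>x. complex_of_real (x i))"
proof -
  have "(\<lambda>x. complex_of_real (x i)) \<in> borel_measurable (\<Pi>\<^sub>M i\<in>I. lborel)"
    using measurable_component_singleton[OF assms, of "\<lambda>_. lborel :: real measure"]
    by (simp add: borel_measurable_of_real)
  moreover have "\<exists>p. \<forall>t. complex_of_real ((x(j := t)) i) = poly p (complex_of_real t)" for x j
    by (cases "i = j") (auto intro: exI[of _ "[:0, 1:]"] exI[of _ "[:complex_of_real (x i):]"])
  ultimately show ?thesis
    unfolding separately_polynomial_def by blast
qed

lemma separately_polynomial_add:
  assumes "separately_polynomial I F" "separately_polynomial I G"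
  shows "separately_polynomial I (\<lambda>x. F x + G x)"
  unfolding separately_polynomial_def
proof (intro conjI allI ballI)
  show "(\<lambda>x. F x + G x) \<in> borel_measurable (\<Pi>\<^sub>M i\<in>I. lborel)"
    using assms unfolding separately_polynomial_def by auto
next
  fix x i assume "i \<in> I"
  then obtain p q where "\<And>t. F (x(i := t)) = poly p (complex_of_real t)"
    "\<And>t. G (x(i := t)) = poly q (complex_of_real t)"
    using assms unfolding separately_polynomial_def by metis
  then show "\<exists>p. \<forall>t. F (x(i := t)) + G (x(i := t)) = poly p (complex_of_real t)"
    by (intro exI[of _ "p + q"]) simp
qed

lemma separately_polynomial_mult:
  assumes "separately_polynomial I F" "separately_polynomial I G"
  shows "separately_polynomial I (\<lambda>x. F x * G x)"
  unfolding separately_polynomial_def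
proof (intro conjI allI ballI)
  show "(\<lambda>x. F x * G x) \<in> borel_measurable (\<Pi>\<^sub>M i\<in>I. lborel)"
    using assms unfolding separately_polynomial_def by auto
next
  fix x i assume "i \<in> I"
  then obtain p q where "\<And>t. F (x(i := t)) = poly p (complex_of_real t)"
    "\<And>t. G (x(i := t)) = poly q (complex_of_real t)"
    using assms unfolding separately_polynomial_def by metis
  then show "\<exists>p. \<forall>t. F (x(i := t)) * G (x(i := t)) = poly p (complex_of_real t)"
    by (intro exI[of _ "p * q"]) simp
qed

lemma separately_polynomial_sum:
  assumes "\<And>a. a \<in> A \<Longrightarrow> separately_polynomial I (F a)"
  shows "separately_polynomial I (\<lambda>x. \<Sum>a\<in>A. F a x)"
  using assms
  by (induction A rule: infinite_finite_induct)
     (auto intro: separately_polynomial_const separately_polynomial_add)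

lemma separately_polynomial_prod:
  assumes "\<And>a. a \<in> A \<Longrightarrow> separately_polynomial I (F a)"
  shows "separately_polynomial I (\<lambda>x. \<Prod>a\<in>A. F a x)"
  using assms
  by (induction A rule: infinite_finite_induct)
     (auto intro: separately_polynomial_const separately_polynomial_mult)

text \<open>Freezing one coordinate passes from \<open>insert i I\<close> to \<open>I\<close>, as
  the induction over the number of variables requires. Updates at distinct points commute.\<close>

lemma separately_polynomial_fix:
  assumes "separately_polynomial (insert i I) F" "i \<notin> I"
  shows "separately_polynomial I (\<lambda>x. F (x(i := c)))"
  unfolding separately_polynomial_def
proof (intro conjI allI ballI)
  have "(\<lambda>x. x(i := c)) \<in> measurable (\<Pi>\<^sub>M i\<in>I. lborel) (\<Pi>\<^sub>M i\<in>insert i I. (lborel :: real measure))"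
    by (rule measurable_fun_upd[where J = I]) auto
  then show "(\<lambda>x. F (x(i := c))) \<in> borel_measurable (\<Pi>\<^sub>M i\<in>I. lborel)"
    using assms(1) unfolding separately_polynomial_def by (auto intro: measurable_compose)
next
  fix x j assume "j \<in> I"
  then have "\<exists>p. \<forall>t. F ((x(i := c))(j := t)) = poly p (complex_of_real t)"
    using assms(1) unfolding separately_polynomial_def by blast
  moreover have "(x(i := c))(j := t) = (x(j := t))(i := c)" for t
    using \<open>j \<in> I\<close> assms(2) by (auto simp: fun_upd_twist)
  ultimately show "\<exists>p. \<forall>t. F ((x(j := t))(i := c)) = poly p (complex_of_real t)"
    by simp
qed

text \<open>Induction on the number of variables. With coordinate \<open>i\<close> frozen at
  \<open>x0 i\<close>, the induction hypothesis shows that for almost all values of the other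
  coordinates \<open>F\<close> is a nonzero polynomial in the \<open>i\<close>-th one. Such a
  polynomial has finitely many roots, and Tonelli concludes.\<close>

lemma AE_separately_polynomial_nonzero:
  assumes "finite I" "separately_polynomial I F"
    and "x0 \<in> space (\<Pi>\<^sub>M i\<in>I. lborel)" "F x0 \<noteq> 0"
  shows "AE x in (\<Pi>\<^sub>M i\<in>I. lborel). F x \<noteq> 0"
  using assms
proof (induction I arbitrary: F x0 rule: finite_induct)
  case empty
  have "x = x0" if "x \<in> space (\<Pi>\<^sub>M i\<in>{}. lborel)" for x
    using that empty.prems(2) by (simp add: space_PiM)
  then show ?case
    using empty.prems(3) by (intro AE_I2) auto
next
  case (insert i I)
  interpret product_sigma_finite "\<lambda>_. lborel :: real measure" by standard
  let ?M = "\<Pi>\<^sub>M i\<in>I. (lborel :: real measure)" and ?M' = "\<Pi>\<^sub>M i\<in>insert i I. (lborel :: real measure)"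
  \<comment> \<open>The indicator of the zero set, which is null as soon as the integral of
    \<open>h\<close> vanishes.\<close>
  define h where "h x = (if F x = 0 then 1 else 0 :: ennreal)" for x
  have [measurable]: "F \<in> borel_measurable ?M'"
    using insert.prems(1) unfolding separately_polynomial_def by blast
  have [measurable]: "h \<in> borel_measurable ?M'"
    unfolding h_def by measurable
  have "AE x in ?M. F (x(i := x0 i)) \<noteq> 0"
  proof (rule insert.IH[OF separately_polynomial_fix[OF insert.prems(1) insert.hyps(2)]])
    show "restrict x0 I \<in> space ?M"
      by (simp add: space_PiM)
    have "(restrict x0 I)(i := x0 i) = x0"
      using insert.prems(2) by (auto simp: space_PiM PiE_def extensional_def fun_eq_iff)
    then show "F ((restrict x0 I)(i := x0 i)) \<noteq> 0"
      using insert.prems(3) by simp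
  qed
  then have inner: "AE x in ?M. (\<integral>\<^sup>+ y. h (x(i := y)) \<partial>lborel) = 0"
  proof (rule AE_mp, intro AE_I2 impI)
    fix x assume x: "x \<in> space ?M" and nz: "F (x(i := x0 i)) \<noteq> 0"
    obtain p where p: "\<And>t. F (x(i := t)) = poly p (complex_of_real t)"
      using insert.prems(1) unfolding separately_polynomial_def by blast
    have "p \<noteq> 0" using nz p by auto
    then have "finite {z. poly p z = 0}" by (rule poly_roots_finite)
    then have fin: "finite (complex_of_real -` {z. poly p z = 0})"
      by (rule finite_vimageI) (simp add: inj_def)
    have "AE y in lborel. y \<notin> complex_of_real -` {z. poly p z = 0}"
      by (rule AE_not_in) (rule finite_imp_null_set_lborel[OF fin])
    then have "AE y in lborel. h (x(i := y)) = 0"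
      by (rule AE_mp) (auto simp: h_def p)
    then show "(\<integral>\<^sup>+ y. h (x(i := y)) \<partial>lborel) = 0"
      by (simp cong: nn_integral_cong_AE)
  qed
  have "(\<integral>\<^sup>+ x. h x \<partial>?M') = (\<integral>\<^sup>+ x. (\<integral>\<^sup>+ y. h (x(i := y)) \<partial>lborel) \<partial>?M)"
    by (rule product_nn_integral_insert[OF insert.hyps]) measurable
  also have "\<dots> = 0"
    using inner by (simp cong: nn_integral_cong_AE)
  finally have "AE x in ?M'. h x = 0"
    by (subst (asm) nn_integral_0_iff_AE) auto
  then show ?case
    by (rule AE_mp) (auto simp: h_def)
qed

text \<open>Finitely many generic conditions hold simultaneously almost everywhere, hence somewhere.
  This turns separate witnesses into a common one.\<close>

lemma separately_polynomial_common_nonzero: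
  assumes "finite I" "finite A" "\<And>a. a \<in> A \<Longrightarrow> separately_polynomial I (F a)"
    and "\<And>a. a \<in> A \<Longrightarrow> \<exists>x \<in> extensional I. F a x \<noteq> 0"
  shows "\<exists>x. \<forall>a\<in>A. F a x \<noteq> 0"
proof -
  interpret product_sigma_finite "\<lambda>_. lborel :: real measure" by standard
  let ?M = "\<Pi>\<^sub>M i\<in>I. (lborel :: real measure)"
  have "AE x in ?M. \<forall>a\<in>A. F a x \<noteq> 0"
  proof (rule AE_finite_allI[OF assms(2)])
    fix a assume "a \<in> A"
    then obtain x where "x \<in> extensional I" "F a x \<noteq> 0" using assms(4) by blast
    then show "AE x in ?M. F a x \<noteq> 0"
      using AE_separately_polynomial_nonzero[OF assms(1) assms(3)[OF \<open>a \<in> A\<close>], of x]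
      by (simp add: space_PiM PiE_def)
  qed
  \<comment> \<open>The whole space is not null: its measure is a product of infinite factors, or
    the empty product 1.\<close>
  moreover have "\<not> (AE x in ?M. False)"
  proof -
    have "emeasure ?M (\<Pi>\<^sub>E i\<in>I. UNIV) = (\<Prod>i\<in>I. emeasure lborel (UNIV :: real set))"
      by (rule emeasure_PiM[OF assms(1)]) auto
    then have "emeasure ?M (space ?M) \<noteq> 0"
      using assms(1) by (simp add: space_PiM)
    then show ?thesis
      by (subst AE_iff_measurable[OF sets.top]) auto
  qed
  ultimately have "\<not> (\<forall>x. \<not> (\<forall>a\<in>A. F a x \<noteq> 0))"
    by (auto simp only: HOL.simp_thms)
  then show ?thesis by blast
qed

section \<open>A discriminant for gaps\<close>

definition mat_trace :: "complex mat \<Rightarrow> complex" where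
  "mat_trace A = (\<Sum>i<dim_row A. A $$ (i, i))"

lemma mat_trace_mult_commute:
  assumes "A \<in> carrier_mat n n" "B \<in> carrier_mat n n"
  shows "mat_trace (A * B) = mat_trace (B * A)"
proof -
  have "mat_trace (A * B) = (\<Sum>i<n. \<Sum>j<n. A $$ (i, j) * B $$ (j, i))"
    using assms by (auto simp: mat_trace_def scalar_prod_def atLeast0LessThan intro!: sum.cong)
  also have "\<dots> = (\<Sum>j<n. \<Sum>i<n. A $$ (i, j) * B $$ (j, i))"
    by (rule sum.swap)
  also have "\<dots> = mat_trace (B * A)"
    using assms by (auto simp: mat_trace_def scalar_prod_def atLeast0LessThan mult.commute intro!: sum.cong)
  finally show ?thesis .
qed

lemma upper_triangular_power:
  assumes B: "(B :: complex mat) \<in> carrier_mat n n" and ut: "upper_triangular B"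
  shows "upper_triangular (B ^\<^sub>m m) \<and> (\<forall>i<n. (B ^\<^sub>m m) $$ (i, i) = (B $$ (i, i)) ^ m)"
proof (induction m)
  case 0
  then show ?case using B by auto
next
  case (Suc m)
  have Bm: "B ^\<^sub>m m \<in> carrier_mat n n" using B by simp
  have entry: "(B ^\<^sub>m Suc m) $$ (i, j) = (\<Sum>k<n. (B ^\<^sub>m m) $$ (i, k) * B $$ (k, j))"
    if "i < n" "j < n" for i j
    using that B Bm by (simp add: scalar_prod_def atLeast0LessThan)
  \<comment> \<open>For \<open>k < i\<close> the first factor lies below the diagonal, for
    \<open>j < k\<close> the second does. Nothing survives if \<open>j < i\<close>, and only
    \<open>k = i\<close> if \<open>j = i\<close>.\<close>
  have zero: "(B ^\<^sub>m m) $$ (i, k) * B $$ (k, j) = 0" if "k < n" "i < n" "j < n" "k < i \<or> j < k" for i j k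
    using that B Bm Suc ut by (auto simp: upper_triangular_def)
  show ?case
  proof (intro conjI allI impI)
    show "upper_triangular (B ^\<^sub>m Suc m)"
    proof (rule upper_triangularI)
      fix i j assume "j < i" "i < dim_row (B ^\<^sub>m Suc m)"
      then have ij: "j < i" "i < n" "j < n" using B by auto
      show "(B ^\<^sub>m Suc m) $$ (i, j) = 0"
        unfolding entry[OF ij(2,3)]
      proof (intro sum.neutral ballI)
        fix k assume "k \<in> {..<n}"
        then show "(B ^\<^sub>m m) $$ (i, k) * B $$ (k, j) = 0"
          using ij by (intro zero) auto
      qed
    qed
    fix i assume i: "i < n"
    have "(B ^\<^sub>m Suc m) $$ (i, i) = (B ^\<^sub>m m) $$ (i, i) * B $$ (i, i)"
      unfolding entry[OF i i]
      by (subst sum.remove[of _ i]) (use i in \<open>auto intro!: sum.neutral zero\<close>)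
    then show "(B ^\<^sub>m Suc m) $$ (i, i) = B $$ (i, i) ^ Suc m"
      using Suc i by (simp add: mult.commute)
  qed
qed

text \<open>The eigenvalues are a function on \<open>{..<n}\<close> rather than a list, so that
  power sums, \<open>inj_on\<close> and reindexing by bijections apply directly.\<close>

definition spectrum_family :: "nat \<Rightarrow> complex mat \<Rightarrow> (nat \<Rightarrow> complex) \<Rightarrow> bool" where
  "spectrum_family n A x \<longleftrightarrow> char_poly A = (\<Prod>i<n. [:- x i, 1:])"

lemma prod_list_map_upt: "(\<Prod>i\<leftarrow>[0..<n]. f i) = (\<Prod>i<n. f i :: 'a :: comm_monoid_mult)"
  by (induction n) (auto simp: mult.commute)

lemma spectrum_family_iff_lists_spectrum:
  "spectrum_family n A x \<longleftrightarrow> lists_spectrum A (map x [0..<n])"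
  unfolding spectrum_family_def lists_spectrum_def
  by (simp add: prod_list_map_upt[symmetric] o_def)

lemma spectrum_family_exists:
  assumes "A \<in> carrier_mat n n"
  obtains x where "spectrum_family n A x"
proof -
  obtain es where es: "lists_spectrum A es" "length es = n"
    using lists_spectrum_exists[OF assms] by blast
  then have "map ((!) es) [0..<n] = es" using map_nth by metis
  then have "spectrum_family n A ((!) es)"
    using es(1) by (simp add: spectrum_family_iff_lists_spectrum)
  then show ?thesis by (rule that)
qed

text \<open>Schur triangularisation makes \<open>A\<close> similar to a triangular matrix with the
  \<open>x i\<close> on its diagonal, and the trace is invariant under similarity.\<close>

lemma mat_trace_power:
  assumes A: "A \<in> carrier_mat n n" and x: "spectrum_family n A x"
  shows "mat_trace (A ^\<^sub>m m) = (\<Sum>i<n. x i ^ m)"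
proof -
  obtain B P Q where dec: "schur_decomposition A (map x [0..<n]) = (B, P, Q)"
    by (cases "schur_decomposition A (map x [0..<n])") auto
  have "char_poly A = (\<Prod>e\<leftarrow>map x [0..<n]. [:- e, 1:])"
    using x unfolding spectrum_family_iff_lists_spectrum lists_spectrum_def .
  note schur = schur_decomposition[OF A this dec]
  then have wit: "similar_mat_wit A B P Q" and ut: "upper_triangular B"
    and diag: "diag_mat B = map x [0..<n]" by auto
  note w = similar_mat_witD2[OF A wit]
  have "similar_mat_wit (A ^\<^sub>m m) (B ^\<^sub>m m) P Q"
    by (rule similar_mat_wit_pow[OF wit])
  note wm = similar_mat_witD2[OF pow_carrier_mat[OF A] this]
  have "mat_trace (A ^\<^sub>m m) = mat_trace (P * (B ^\<^sub>m m) * Q)"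
    using wm(3) by simp
  also have "\<dots> = mat_trace (Q * (P * (B ^\<^sub>m m)))"
    by (rule mat_trace_mult_commute) (use wm in auto)
  also have "Q * (P * (B ^\<^sub>m m)) = (Q * P) * (B ^\<^sub>m m)"
    by (rule assoc_mult_mat[symmetric]) (use wm in auto)
  also have "\<dots> = B ^\<^sub>m m" using wm(2) left_mult_one_mat[OF wm(5)] by simp
  also have "mat_trace (B ^\<^sub>m m) = (\<Sum>i<n. (B $$ (i, i)) ^ m)"
    unfolding mat_trace_def using upper_triangular_power[OF w(5) ut] w(5) by simp
  also have "\<dots> = (\<Sum>i<n. x i ^ m)"
  proof (rule sum.cong[OF refl])
    fix i assume "i \<in> {..<n}"
    then have "B $$ (i, i) = diag_mat B ! i" using w(5) by (simp add: diag_mat_def)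
    then show "(B $$ (i, i)) ^ m = x i ^ m" using diag \<open>i \<in> _\<close> by simp
  qed
  finally show ?thesis .
qed

text \<open>The Hankel matrix of power sums is \<open>V V\<^sup>T\<close> for the Vandermonde matrix \<open>V\<close>.\<close>

lemma det_hankel_power_sums:
  fixes y :: "'q \<Rightarrow> complex"
  assumes "finite Q"
  shows "det (mat (card Q) (card Q) (\<lambda>(a, b). \<Sum>q\<in>Q. y q ^ (a + b))) \<noteq> 0 \<longleftrightarrow> inj_on y Q"
proof -
  define L where "L = card Q"
  obtain h where h: "bij_betw h {..<L} Q"
    using ex_bij_betw_nat_finite[OF assms] unfolding L_def atLeast0LessThan by blast
  define V where "V = mat L L (\<lambda>(a, i). y (h i) ^ a)"
  have V: "V \<in> carrier_mat L L" by (simp add: V_def)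
  have "mat L L (\<lambda>(a, b). \<Sum>q\<in>Q. y q ^ (a + b)) = V * V\<^sup>T"
  proof (rule eq_matI)
    fix a b assume "a < dim_row (V * V\<^sup>T)" "b < dim_col (V * V\<^sup>T)"
    then have ab: "a < L" "b < L" using V by auto
    have "(\<Sum>q\<in>Q. y q ^ (a + b)) = (\<Sum>i<L. y (h i) ^ (a + b))"
      by (rule sum.reindex_bij_betw[OF h, symmetric])
    then show "mat L L (\<lambda>(a, b). \<Sum>q\<in>Q. y q ^ (a + b)) $$ (a, b) = (V * V\<^sup>T) $$ (a, b)"
      using ab by (simp add: V_def scalar_prod_def atLeast0LessThan power_add)
  qed (simp_all add: V_def)
  then have "det (mat L L (\<lambda>(a, b). \<Sum>q\<in>Q. y q ^ (a + b))) = det V * det V"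
    using V by (simp add: det_mult[OF V] det_transpose[OF V])
  moreover have "det V \<noteq> 0 \<longleftrightarrow> inj_on y Q"
  proof
    assume nz: "det V \<noteq> 0"
    show "inj_on y Q"
    proof (rule inj_onI, rule ccontr)
      fix q q' assume q: "q \<in> Q" "q' \<in> Q" "y q = y q'" "q \<noteq> q'"
      then obtain i j where ij: "i < L" "j < L" "h i = q" "h j = q'"
        using h unfolding bij_betw_def by blast
      have "col V i = col V j"
        using ij q by (intro eq_vecI) (auto simp: V_def)
      then have "det V = 0"
        using det_identical_columns[OF V, of i j] ij q by blast
      then show False using nz by simp
    qed
  next
    assume inj: "inj_on y Q"
    show "det V \<noteq> 0"
    proof
      assume "det V = 0"
      then have "det (V\<^sup>T) = 0" using det_transpose[OF V] by simp
      then obtain v where v: "v \<in> carrier_vec L" "v \<noteq> 0\<^sub>v L" "V\<^sup>T *\<^sub>v v = 0\<^sub>v L"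
        using det_0_iff_vec_prod_zero[of "V\<^sup>T" L] V by auto
      \<comment> \<open>A kernel vector of the transposed Vandermonde matrix is the coefficient
        vector of a polynomial of degree below \<open>L\<close> that vanishes at all
        \<open>L\<close> nodes.\<close>
      define p where "p = (\<Sum>a<L. monom (vec_index v a) a)"
      have coeff: "coeff p a = (if a < L then vec_index v a else 0)" for a
        unfolding p_def coeff_sum by simp
      have root: "poly p (y (h i)) = 0" if "i < L" for i
      proof -
        have "vec_index (V\<^sup>T *\<^sub>v v) i = (\<Sum>a<L. y (h i) ^ a * vec_index v a)"
          using that V v(1) by (simp add: scalar_prod_def V_def atLeast0LessThan)
        also have "\<dots> = poly p (y (h i))"
          unfolding p_def poly_sum poly_monom by (simp add: mult.commute)
        finally show ?thesis using v(3) that by simp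
      qed
      have "p = 0"
      proof (rule ccontr)
        assume nz: "p \<noteq> 0"
        have "L \<noteq> 0" using nz p_def by auto
        have "card ((\<lambda>i. y (h i)) ` {..<L}) \<le> card {z. poly p z = 0}"
          by (rule card_mono[OF poly_roots_finite[OF nz]]) (use root in auto)
        also have "\<dots> \<le> degree p"
          by (rule card_poly_roots_bound[OF nz])
        also have "degree p < L"
          using \<open>L \<noteq> 0\<close> coeff by (intro le_less_trans[OF degree_le[of "L - 1"]]) auto
        finally have "card ((\<lambda>i. y (h i)) ` {..<L}) < L" .
        moreover have "inj_on (\<lambda>i. y (h i)) {..<L}"
          using comp_inj_on[of h "{..<L}" y] h inj unfolding bij_betw_def comp_def by auto
        ultimately show False using card_image by fastforce
      qed
      then have "v = 0\<^sub>v L"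
        using coeff v(1) by (intro eq_vecI) (metis coeff_0 index_zero_vec(1) index_zero_vec(2), auto)
      then show False using v(2) by simp
    qed
  qed
  ultimately show ?thesis unfolding L_def by simp
qed

section \<open>Gap determinants of families of matrices\<close>

text \<open>The labels in \<open>S\<close> allow the gaps of several matrices to be compared at
  once; a single matrix is the case \<open>S = {()}\<close>.\<close>

definition gap_index :: "'s set \<Rightarrow> nat \<Rightarrow> ('s \<times> nat \<times> nat) set" where
  "gap_index S n = {(s, i, j). s \<in> S \<and> i < n \<and> j < n \<and> i \<noteq> j}"

lemma gap_index_Sigma: "gap_index S n = (SIGMA s:S. SIGMA i:{..<n}. {..<n} - {i})"
  unfolding gap_index_def by auto

lemma finite_gap_index: "finite S \<Longrightarrow> finite (gap_index S n)"
  unfolding gap_index_Sigma by auto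

lemma card_gap_index: "finite S \<Longrightarrow> card (gap_index S n) = card S * (n * (n - 1))"
  unfolding gap_index_Sigma by simp

text \<open>The subtracted term removes the pairs \<open>i = j\<close> from the binomial expansion.\<close>

definition gap_power_sum :: "nat \<Rightarrow> complex mat \<Rightarrow> nat \<Rightarrow> complex" where
  "gap_power_sum n A m =
     (\<Sum>k\<le>m. of_nat (m choose k) * mat_trace (A ^\<^sub>m k) * ((- 1) ^ (m - k) * mat_trace (A ^\<^sub>m (m - k))))
     - of_nat n * 0 ^ m"

lemma gap_power_sum:
  assumes "A \<in> carrier_mat n n" "spectrum_family n A x"
  shows "gap_power_sum n A m = (\<Sum>i<n. \<Sum>j\<in>{..<n} - {i}. (x i - x j) ^ m)"
proof -
  have "(\<Sum>k\<le>m. of_nat (m choose k) * mat_trace (A ^\<^sub>m k) * ((- 1) ^ (m - k) * mat_trace (A ^\<^sub>m (m - k))))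
      = (\<Sum>k\<le>m. \<Sum>i<n. \<Sum>j<n. of_nat (m choose k) * x i ^ k * (- x j) ^ (m - k))"
  proof (rule sum.cong[OF refl])
    fix k
    have "(- 1) ^ (m - k) * mat_trace (A ^\<^sub>m (m - k)) = (\<Sum>j<n. (- x j) ^ (m - k))"
      unfolding mat_trace_power[OF assms] sum_distrib_left
      by (rule sum.cong[OF refl]) (metis power_minus)
    then show "of_nat (m choose k) * mat_trace (A ^\<^sub>m k) * ((- 1) ^ (m - k) * mat_trace (A ^\<^sub>m (m - k)))
        = (\<Sum>i<n. \<Sum>j<n. of_nat (m choose k) * x i ^ k * (- x j) ^ (m - k))"
      by (simp add: mat_trace_power[OF assms] sum_distrib_left sum_distrib_right mult.assoc)
         (rule sum.swap)
  qed
  also have "\<dots> = (\<Sum>i<n. \<Sum>j<n. \<Sum>k\<le>m. of_nat (m choose k) * x i ^ k * (- x j) ^ (m - k))"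
    by (subst sum.swap, rule sum.cong[OF refl], rule sum.swap)
  also have "\<dots> = (\<Sum>i<n. \<Sum>j<n. (x i - x j) ^ m)"
    by (simp add: binomial_ring[symmetric])
  \<comment> \<open>Each diagonal pair contributes \<open>0 ^ m\<close>, which is 1 when
    \<open>m = 0\<close>.\<close>
  also have "\<dots> = (\<Sum>i<n. 0 ^ m + (\<Sum>j\<in>{..<n} - {i}. (x i - x j) ^ m))"
    by (rule sum.cong[OF refl]) (subst sum.remove[of "{..<n}"], auto)
  finally show ?thesis
    unfolding gap_power_sum_def by (simp add: sum.distrib)
qed

text \<open>A discriminant of the joint family of gaps, expressed through traces of powers so that
  it is visibly polynomial in the matrix entries. The size of the Hankel matrix is the number of
  gaps.\<close>

definition gap_det :: "'s set \<Rightarrow> nat \<Rightarrow> ('s \<Rightarrow> complex mat) \<Rightarrow> complex" where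
  "gap_det S n A =
     det (mat (card S * (n * (n - 1))) (card S * (n * (n - 1)))
       (\<lambda>(a, b). \<Sum>s\<in>S. gap_power_sum n (A s) (a + b)))"

lemma gap_det_nonzero_iff:
  assumes "finite S" "\<And>s. s \<in> S \<Longrightarrow> A s \<in> carrier_mat n n"
    and "\<And>s. s \<in> S \<Longrightarrow> spectrum_family n (A s) (x s)"
  shows "gap_det S n A \<noteq> 0 \<longleftrightarrow> inj_on (\<lambda>(s, i, j). x s i - x s j) (gap_index S n)"
proof -
  have "(\<Sum>s\<in>S. gap_power_sum n (A s) m) = (\<Sum>(s, i, j)\<in>gap_index S n. (x s i - x s j) ^ m)" for m
    unfolding gap_index_Sigma using assms(1)
    by (simp add: sum.Sigma[symmetric] gap_power_sum[OF assms(2,3)])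
  then show ?thesis
    using det_hankel_power_sums[OF finite_gap_index[OF assms(1)], where y = "\<lambda>(s, i, j). x s i - x s j"]
    unfolding gap_det_def card_gap_index[OF assms(1)] by (simp add: case_prod_unfold)
qed

lemma separately_polynomial_power_entry:
  assumes "\<And>x. A x \<in> carrier_mat n n"
    and "\<And>r c. r < n \<Longrightarrow> c < n \<Longrightarrow> separately_polynomial I (\<lambda>x. A x $$ (r, c))"
    and "r < n" "c < n"
  shows "separately_polynomial I (\<lambda>x. (A x ^\<^sub>m m) $$ (r, c))"
  using assms(3,4)
proof (induction m arbitrary: r c)
  case 0
  have "(\<lambda>x. (A x ^\<^sub>m 0) $$ (r, c)) = (\<lambda>x. if r = c then 1 else 0)"
    using carrier_matD(1)[OF assms(1)] 0 by (simp add: fun_eq_iff)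
  then show ?case by (simp only: separately_polynomial_const)
next
  case (Suc m)
  have "(A x ^\<^sub>m Suc m) $$ (r, c) = (\<Sum>k<n. (A x ^\<^sub>m m) $$ (r, k) * A x $$ (k, c))" for x
    using Suc.prems assms(1)[of x] pow_carrier_mat[OF assms(1)[of x], of m]
    by (simp add: scalar_prod_def atLeast0LessThan)
  then show ?case
    using Suc assms(2) by (simp only:) (auto intro!: separately_polynomial_sum separately_polynomial_mult)
qed

lemma separately_polynomial_det:
  assumes "\<And>x. A x \<in> carrier_mat n n"
    and "\<And>r c. r < n \<Longrightarrow> c < n \<Longrightarrow> separately_polynomial I (\<lambda>x. A x $$ (r, c))"
  shows "separately_polynomial I (\<lambda>x. det (A x))"
  unfolding det_def'[OF assms(1)]
  by (intro separately_polynomial_sum separately_polynomial_mult separately_polynomial_const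
      separately_polynomial_prod assms(2)) (auto simp: permutes_in_image)

text \<open>This makes the separation of gaps a generic condition: one parameter value at which it
  holds suffices for almost all.\<close>

lemma separately_polynomial_gap_det:
  assumes "\<And>s x. s \<in> S \<Longrightarrow> A s x \<in> carrier_mat n n"
    and "\<And>s r c. s \<in> S \<Longrightarrow> r < n \<Longrightarrow> c < n \<Longrightarrow> separately_polynomial I (\<lambda>x. A s x $$ (r, c))"
  shows "separately_polynomial I (\<lambda>x. gap_det S n (\<lambda>s. A s x))"
  unfolding gap_det_def
proof (rule separately_polynomial_det)
  have trace: "separately_polynomial I (\<lambda>x. mat_trace (A s x ^\<^sub>m m))" if s: "s \<in> S" for s m
  proof -
    have "dim_row (A s x ^\<^sub>m m) = n" for x
      using carrier_matD(1)[OF pow_carrier_mat[OF assms(1)[OF s, of x], of m]] .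
    then show ?thesis
      unfolding mat_trace_def
      using separately_polynomial_power_entry[OF assms(1)[OF s] assms(2)[OF s]]
      by (auto intro!: separately_polynomial_sum)
  qed
  have "separately_polynomial I (\<lambda>x. gap_power_sum n (A s x) m)" if s: "s \<in> S" for s m
    unfolding gap_power_sum_def diff_conv_add_uminus
    by (intro separately_polynomial_add separately_polynomial_sum separately_polynomial_mult
        separately_polynomial_const trace s)
  then show "separately_polynomial I (\<lambda>x. mat (card S * (n * (n - 1))) (card S * (n * (n - 1)))
      (\<lambda>(a, b). \<Sum>s\<in>S. gap_power_sum n (A s x) (a + b)) $$ (r, c))"
    if "r < card S * (n * (n - 1))" "c < card S * (n * (n - 1))" for r c
    using that by (auto intro!: separately_polynomial_sum)
qed simp

section \<open>A spin in a strong field\<close>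

text \<open>If all roots are at distance at least \<open>\<delta>\<close> from \<open>u\<close>, then
  \<open>\<bar>f u'\<bar> \<le> \<bar>f u\<bar> (1 + \<bar>u' - u\<bar> / \<delta>)\<^sup>d\<close>, which is impossible in the limit.
  The leading coefficient need not converge, so roots may escape to infinity.\<close>

lemma eventually_root_near:
  fixes f :: "'s \<Rightarrow> complex \<Rightarrow> complex" and y :: "'s \<Rightarrow> nat \<Rightarrow> complex"
  assumes f: "\<forall>\<^sub>F s in F. \<forall>\<xi>. f s \<xi> = k s * (\<Prod>i<d. (\<xi> - y s i))"
    and u: "((\<lambda>s. f s u) \<longlongrightarrow> 0) F" and u': "((\<lambda>s. f s u') \<longlongrightarrow> w) F" "w \<noteq> 0"
    and "\<delta> > 0"
  shows "\<forall>\<^sub>F s in F. \<exists>i<d. cmod (y s i - u) < \<delta>"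
proof -
  define C where "C = (1 + cmod (u' - u) / \<delta>) ^ d"
  have "((\<lambda>s. cmod (f s u) * C) \<longlongrightarrow> cmod 0 * C) F"
    by (intro tendsto_intros u)
  then have ev1: "\<forall>\<^sub>F s in F. cmod (f s u) * C < cmod w / 2"
    using u'(2) by (intro order_tendstoD(2)) auto
  have "((\<lambda>s. cmod (f s u')) \<longlongrightarrow> cmod w) F"
    by (intro tendsto_intros u')
  then have ev2: "\<forall>\<^sub>F s in F. cmod w / 2 < cmod (f s u')"
    using u'(2) by (intro order_tendstoD(1)) auto
  show ?thesis
    using f ev1 ev2
  proof eventually_elim
    case (elim s)
    show ?case
    proof (rule ccontr)
      assume "\<not> ?thesis"
      then have far: "\<delta> \<le> cmod (u - y s i)" if "i < d" for i
        using that by (force simp: norm_minus_commute)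
      have "cmod (u' - y s i) \<le> cmod (u - y s i) * (1 + cmod (u' - u) / \<delta>)" if "i < d" for i
      proof -
        have "cmod (u' - y s i) \<le> cmod (u - y s i) + cmod (u' - u)"
          using norm_triangle_ineq[of "u - y s i" "u' - u"] by (simp add: algebra_simps)
        also have "cmod (u' - u) \<le> cmod (u - y s i) * (cmod (u' - u) / \<delta>)"
          using far[OF that] \<open>\<delta> > 0\<close> mult_right_mono[of \<delta> "cmod (u - y s i)" "cmod (u' - u)"]
          by (simp add: field_simps)
        finally show ?thesis by (simp add: algebra_simps)
      qed
      then have "(\<Prod>i<d. cmod (u' - y s i)) \<le> (\<Prod>i<d. cmod (u - y s i) * (1 + cmod (u' - u) / \<delta>))"
        by (intro prod_mono) auto
      also have "\<dots> = (\<Prod>i<d. cmod (u - y s i)) * C"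
        by (simp add: prod.distrib C_def)
      finally have "cmod (k s) * (\<Prod>i<d. cmod (u' - y s i)) \<le> cmod (k s) * ((\<Prod>i<d. cmod (u - y s i)) * C)"
        by (rule mult_left_mono) simp
      then have "cmod (f s u') \<le> cmod (f s u) * C"
        using elim(1) by (simp add: norm_mult prod_norm mult.assoc)
      then show False using elim by linarith
    qed
  qed
qed

text \<open>Points with different slopes \<open>\<kappa> q\<close> drift apart as \<open>s\<close>
  grows. Points with equal slope keep the distance of their offsets \<open>w q\<close>, and half the
  smallest such distance can serve as tolerance.\<close>

lemma eventually_inj_on_near_affine:
  fixes w :: "'q \<Rightarrow> complex" and \<kappa> :: "'q \<Rightarrow> real"
  assumes "finite Q" "inj_on (\<lambda>q. (w q, \<kappa> q)) Q"
  shows "\<exists>\<delta>>0. \<forall>\<^sub>F s in at_top. \<forall>g.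
           (\<forall>q\<in>Q. cmod (g q - (w q + complex_of_real (\<kappa> q * s))) < \<delta>) \<longrightarrow> inj_on g Q"
proof -
  \<comment> \<open>The element 2 keeps \<open>D\<close> nonempty, so that \<open>Min D\<close> is
    meaningful when all offsets coincide.\<close>
  define D where "D = insert 2 ((\<lambda>(q, q'). cmod (w q - w q')) ` {(q, q') \<in> Q \<times> Q. w q \<noteq> w q'})"
  have finD: "finite D"
    unfolding D_def using assms(1) by (auto intro: finite_subset[of _ "Q \<times> Q"])
  define \<delta> where "\<delta> = Min D / 2"
  have "Min D > 0"
    using finD by (subst Min_gr_iff) (auto simp: D_def)
  then have "\<delta> > 0" by (simp add: \<delta>_def)
  have \<delta>: "2 * \<delta> \<le> cmod (w q - w q')" if "q \<in> Q" "q' \<in> Q" "w q \<noteq> w q'" for q q'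
  proof -
    have "cmod (w q - w q') \<in> D" unfolding D_def using that by auto
    then show ?thesis unfolding \<delta>_def using Min_le[OF finD] by simp
  qed
  have "\<forall>\<^sub>F s in at_top. \<forall>q\<in>Q. \<forall>q'\<in>Q. \<kappa> q \<noteq> \<kappa> q' \<longrightarrow>
      (cmod (w q - w q') + 2 * \<delta>) / \<bar>\<kappa> q - \<kappa> q'\<bar> < s"
    using assms(1) by (auto intro!: eventually_ball_finite eventually_gt_at_top simp: eventually_conj_iff)
  then have "\<forall>\<^sub>F s in at_top. \<forall>g.
      (\<forall>q\<in>Q. cmod (g q - (w q + complex_of_real (\<kappa> q * s))) < \<delta>) \<longrightarrow> inj_on g Q"
    using eventually_gt_at_top[of 0]
  proof eventually_elim
    case (elim s)
    show ?case
    proof (intro allI impI inj_onI, rule ccontr)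
      fix g q q'
      assume g: "\<forall>q\<in>Q. cmod (g q - (w q + complex_of_real (\<kappa> q * s))) < \<delta>"
        and q: "q \<in> Q" "q' \<in> Q" "g q = g q'" "q \<noteq> q'"
      have "(w q - w q') + complex_of_real ((\<kappa> q - \<kappa> q') * s)
          = (g q' - (w q' + complex_of_real (\<kappa> q' * s))) - (g q - (w q + complex_of_real (\<kappa> q * s)))"
        using q(3) by (simp add: algebra_simps)
      also have "cmod \<dots> \<le> cmod (g q' - (w q' + complex_of_real (\<kappa> q' * s)))
          + cmod (g q - (w q + complex_of_real (\<kappa> q * s)))"
        by (rule norm_triangle_ineq4)
      also have "\<dots> < 2 * \<delta>"
        using bspec[OF g q(1)] bspec[OF g q(2)] by linarith
      finally have less: "cmod ((w q - w q') + complex_of_real ((\<kappa> q - \<kappa> q') * s)) < 2 * \<delta>" .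
      show False
      proof (cases "\<kappa> q = \<kappa> q'")
        case True
        then have "w q \<noteq> w q'" using q assms(2) by (auto dest: inj_onD)
        then show False using \<delta>[OF q(1,2)] less True by simp
      next
        case False
        have "cmod (complex_of_real ((\<kappa> q - \<kappa> q') * s)) - cmod (w q - w q') < 2 * \<delta>"
          using less norm_triangle_ineq2[of "complex_of_real ((\<kappa> q - \<kappa> q') * s)" "w q' - w q"]
          by (simp add: norm_minus_commute algebra_simps)
        then have "\<bar>\<kappa> q - \<kappa> q'\<bar> * s < cmod (w q - w q') + 2 * \<delta>"
          using elim(2) by (simp add: norm_mult abs_mult flip: of_real_diff)
        moreover have "cmod (w q - w q') + 2 * \<delta> < \<bar>\<kappa> q - \<kappa> q'\<bar> * s"
          using elim(1) q False by (simp add: divide_less_eq mult.commute)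
        ultimately show False by simp
      qed
    qed
  qed
  then show ?thesis using \<open>\<delta> > 0\<close> by blast
qed

lemma tendsto_det:
  fixes A :: "'s \<Rightarrow> complex mat"
  assumes "\<And>s. A s \<in> carrier_mat n n" "B \<in> carrier_mat n n"
    and "\<And>i j. i < n \<Longrightarrow> j < n \<Longrightarrow> ((\<lambda>s. A s $$ (i, j)) \<longlongrightarrow> B $$ (i, j)) F"
  shows "((\<lambda>s. det (A s)) \<longlongrightarrow> det B) F"
  unfolding det_def'[OF assms(1)] det_def'[OF assms(2)]
  by (intro tendsto_intros tendsto_prod assms(3)) (auto simp: permutes_in_image)

text \<open>A new first spin in the field \<open>a X + b Z\<close>; \<open>W\<close> is what its \<open>Z\<close> is coupled to.\<close>

definition attach_spin :: "nat \<Rightarrow> complex \<Rightarrow> complex \<Rightarrow> complex mat \<Rightarrow> complex mat \<Rightarrow> complex mat" where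
  "attach_spin n a b W H =
     four_block_mat (H + W + b \<cdot>\<^sub>m 1\<^sub>m n) (a \<cdot>\<^sub>m 1\<^sub>m n) (a \<cdot>\<^sub>m 1\<^sub>m n) (H - W - b \<cdot>\<^sub>m 1\<^sub>m n)"

lemma attach_spin_carrier:
  assumes "H \<in> carrier_mat n n" "W \<in> carrier_mat n n"
  shows "attach_spin n a b W H \<in> carrier_mat (2 * n) (2 * n)"
  using assms unfolding attach_spin_def carrier_mat_def by simp

text \<open>The off-diagonal blocks are scalar, so the determinant of the block matrix is that of a single
  matrix of size \<open>n\<close>; dividing by \<open>2 r\<close> isolates the part that survives as \<open>r\<close> tends to infinity.
  Replacing \<open>r\<close> by \<open>- r\<close> treats the other half of the spectrum.\<close>

lemma char_poly_attach_spin: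
  assumes H: "H \<in> carrier_mat n n" and W: "W \<in> carrier_mat n n"
    and r: "a\<^sup>2 + b\<^sup>2 = r\<^sup>2" "r \<noteq> 0"
  defines "\<Xi> \<equiv> \<lambda>\<xi>. \<xi> \<cdot>\<^sub>m 1\<^sub>m n - H"
  shows "poly (char_poly (attach_spin n a b W H)) (r + \<xi>) =
    (2 * r) ^ n * det (\<Xi> \<xi> - (b / r) \<cdot>\<^sub>m W + (1 / (2 * r)) \<cdot>\<^sub>m ((\<Xi> \<xi> - W) * (\<Xi> \<xi> + W)))"
proof -
  define P where "P = \<Xi> \<xi> - W"
  define Q where "Q = \<Xi> \<xi> + W"
  have P: "P \<in> carrier_mat n n" and Q: "Q \<in> carrier_mat n n"
    using H W by (auto simp: P_def Q_def \<Xi>_def)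
  define A where "A = P + (r - b) \<cdot>\<^sub>m 1\<^sub>m n"
  define B where "B = (- a) \<cdot>\<^sub>m 1\<^sub>m n"
  define D where "D = Q + (r + b) \<cdot>\<^sub>m 1\<^sub>m n"
  have A: "A \<in> carrier_mat n n" and B: "B \<in> carrier_mat n n" and D: "D \<in> carrier_mat n n"
    using P Q by (auto simp: A_def B_def D_def)
  have "- char_matrix (attach_spin n a b W H) (r + \<xi>) = four_block_mat A B B D"
    using H W
    by (intro eq_matI)
       (auto simp: char_matrix_def attach_spin_def A_def B_def D_def P_def Q_def \<Xi>_def algebra_simps)
  then have "poly (char_poly (attach_spin n a b W H)) (r + \<xi>) = det (four_block_mat A B B D)"
    using char_poly_matrix[OF attach_spin_carrier[OF H W]] by simp
  \<comment> \<open>The block determinant formula needs the two lower blocks to commute; the left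
    one is scalar.\<close>
  also have "\<dots> = det (A * D - B * B)"
    by (rule det_four_block_mat[OF A B B D]) (use D mult_smult_assoc_mat[OF one_carrier_mat D] mult_smult_distrib[OF D one_carrier_mat] in \<open>simp add: B_def\<close>)
  also have "A * D = P * Q + (r + b) \<cdot>\<^sub>m P + (r - b) \<cdot>\<^sub>m Q + ((r - b) * (r + b)) \<cdot>\<^sub>m 1\<^sub>m n"
  proof -
    have "A * D = P * D + ((r - b) \<cdot>\<^sub>m 1\<^sub>m n) * D"
      unfolding A_def by (rule add_mult_distrib_mat[OF P _ D]) simp
    also have "((r - b) \<cdot>\<^sub>m 1\<^sub>m n) * D = (r - b) \<cdot>\<^sub>m D"
      using mult_smult_assoc_mat[OF one_carrier_mat D] D by simp
    also have "P * D = P * Q + P * ((r + b) \<cdot>\<^sub>m 1\<^sub>m n)"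
      unfolding D_def by (rule mult_add_distrib_mat[OF P Q]) simp
    also have "P * ((r + b) \<cdot>\<^sub>m 1\<^sub>m n) = (r + b) \<cdot>\<^sub>m P"
      using P by (simp add: mult_smult_distrib[OF P, of _ n])
    finally show ?thesis
      unfolding D_def using P Q by (intro eq_matI) (auto simp: algebra_simps)
  qed
  also have "B * B = (a * a) \<cdot>\<^sub>m 1\<^sub>m n"
    unfolding B_def by (intro eq_matI) auto
  \<comment> \<open>By \<open>(r - b) * (r + b) = a * a\<close> the terms quadratic in the field
    cancel. What remains is the product \<open>P * Q\<close> and a part linear in \<open>r\<close>
    and \<open>b\<close>.\<close>
  also have "P * Q + (r + b) \<cdot>\<^sub>m P + (r - b) \<cdot>\<^sub>m Q + ((r - b) * (r + b)) \<cdot>\<^sub>m 1\<^sub>m n - (a * a) \<cdot>\<^sub>m 1\<^sub>m n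
      = (2 * r) \<cdot>\<^sub>m (\<Xi> \<xi> - (b / r) \<cdot>\<^sub>m W + (1 / (2 * r)) \<cdot>\<^sub>m (P * Q))" (is "?L = ?R")
  proof (rule eq_matI)
    fix i j assume "i < dim_row ?R" "j < dim_col ?R"
    then have ij: "i < n" "j < n" using P Q H W by auto
    have PQ: "P * Q \<in> carrier_mat n n" using P Q by simp
    have sq: "(r - b) * (r + b) = a * a"
      using r(1) by (simp add: algebra_simps power2_eq_square)
    have "?L $$ (i, j) = (P * Q) $$ (i, j) + ((r + b) * P $$ (i, j) + (r - b) * Q $$ (i, j))"
      using ij PQ P Q by (simp add: sq del: index_mult_mat)
    also have "(r + b) * P $$ (i, j) + (r - b) * Q $$ (i, j) = 2 * r * \<Xi> \<xi> $$ (i, j) - 2 * b * W $$ (i, j)"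
      using ij H W by (simp add: P_def Q_def \<Xi>_def algebra_simps)
    also have "(P * Q) $$ (i, j) + \<dots> = ?R $$ (i, j)"
      using ij PQ W H r(2) by (simp add: \<Xi>_def field_simps del: index_mult_mat)
    finally show "?L $$ (i, j) = ?R $$ (i, j)" .
  qed (use P Q H W in \<open>auto simp: \<Xi>_def\<close>)
  also have "det \<dots> = (2 * r) ^ n * det (\<Xi> \<xi> - (b / r) \<cdot>\<^sub>m W + (1 / (2 * r)) \<cdot>\<^sub>m (P * Q))"
    using P Q H W by (simp add: \<Xi>_def)
  finally show ?thesis unfolding P_def Q_def .
qed

text \<open>Shifted by \<open>\<rho> * s\<close> and normalised, the characteristic polynomial
  converges pointwise to that of \<open>H\<close> plus \<open>\<tau>\<close> times \<open>W\<close>.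
  So each root \<open>u i\<close> of the limit attracts an eigenvalue. The sign of
  \<open>\<rho>\<close> is free, which covers both orientations of the new spin.\<close>

lemma attach_spin_eigenvalue_near:
  fixes a b \<rho> \<tau> :: real
  assumes H: "H \<in> carrier_mat n n" and W: "W \<in> carrier_mat n n"
    and \<rho>: "a\<^sup>2 + b\<^sup>2 = \<rho>\<^sup>2" "\<rho> \<noteq> 0" "b = \<tau> * \<rho>"
    and y: "\<And>s. spectrum_family (2 * n)
      (attach_spin n (complex_of_real (a * s)) (complex_of_real (b * s)) W H) (y s)"
    and u: "spectrum_family n (H + complex_of_real \<tau> \<cdot>\<^sub>m W) u"
    and "i < n" "\<delta> > 0"
  shows "\<forall>\<^sub>F s in at_top. \<exists>j<2 * n. cmod (y s j - (u i + complex_of_real (\<rho> * s))) < \<delta>"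
proof -
  define \<Xi> where "\<Xi> \<xi> = \<xi> \<cdot>\<^sub>m 1\<^sub>m n - H" for \<xi>
  define G where "G s \<xi> = \<Xi> \<xi> - complex_of_real \<tau> \<cdot>\<^sub>m W
      + (1 / (2 * complex_of_real (\<rho> * s))) \<cdot>\<^sub>m ((\<Xi> \<xi> - W) * (\<Xi> \<xi> + W))" for s \<xi>
  define f where "f s \<xi> = det (G s \<xi>)" for s \<xi>
  have f_eq: "\<forall>\<^sub>F s in at_top. \<forall>\<xi>. f s \<xi> = inverse ((2 * complex_of_real (\<rho> * s)) ^ n)
      * (\<Prod>j<2 * n. \<xi> - (y s j - complex_of_real (\<rho> * s)))"
    using eventually_gt_at_top[of 0]
  proof eventually_elim
    case (elim s)
    show ?case
    proof
      fix \<xi>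
      let ?r = "complex_of_real (\<rho> * s)"
      have nz: "?r \<noteq> 0" using elim \<rho>(2) by simp
      have "(a * s)\<^sup>2 + (b * s)\<^sup>2 = (\<rho> * s)\<^sup>2"
        using \<rho>(1) by (metis distrib_right power_mult_distrib)
      then have sq: "(complex_of_real (a * s))\<^sup>2 + (complex_of_real (b * s))\<^sup>2 = ?r\<^sup>2"
        by (metis of_real_add of_real_power)
      have quot: "complex_of_real (b * s) / ?r = complex_of_real \<tau>"
        using nz \<rho>(3) elim by simp
      have "(2 * ?r) ^ n * f s \<xi> = poly (char_poly
          (attach_spin n (complex_of_real (a * s)) (complex_of_real (b * s)) W H)) (?r + \<xi>)"
        unfolding char_poly_attach_spin[OF H W sq nz] f_def G_def \<Xi>_def quot ..
      also have "\<dots> = (\<Prod>j<2 * n. \<xi> - (y s j - ?r))"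
        using y[of s] unfolding spectrum_family_def
        by (simp add: poly_prod algebra_simps)
      finally show "f s \<xi> = inverse ((2 * ?r) ^ n) * (\<Prod>j<2 * n. \<xi> - (y s j - ?r))"
        using nz by (simp add: field_simps)
    qed
  qed
  have lim: "((\<lambda>s. f s \<xi>) \<longlongrightarrow> (\<Prod>i<n. \<xi> - u i)) at_top" for \<xi>
  proof -
    have HW: "H + complex_of_real \<tau> \<cdot>\<^sub>m W \<in> carrier_mat n n" using H W by simp
    have PQ: "(\<Xi> \<xi> - W) * (\<Xi> \<xi> + W) \<in> carrier_mat n n" using H W
      by (intro mult_carrier_mat[where n = n]) (auto simp: \<Xi>_def)
    have "filterlim (\<lambda>s. complex_of_real (2 * \<rho>) * complex_of_real s) at_infinity at_top"
      using \<rho>(2) by (intro tendsto_mult_filterlim_at_infinity[OF tendsto_const]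
          filterlim_of_real_at_infinity) auto
    then have "filterlim (\<lambda>s. 2 * complex_of_real (\<rho> * s)) at_infinity at_top"
      by (simp add: mult.assoc)
    then have inv: "((\<lambda>s. 1 / (2 * complex_of_real (\<rho> * s))) \<longlongrightarrow> 0) at_top"
      by (intro tendsto_divide_0[OF tendsto_const])
    have "((\<lambda>s. det (G s \<xi>)) \<longlongrightarrow> det (- char_matrix (H + complex_of_real \<tau> \<cdot>\<^sub>m W) \<xi>)) at_top"
    proof (rule tendsto_det[where n = n])
      fix i j assume ij: "i < n" "j < n"
      have "((\<lambda>s. (\<Xi> \<xi> - complex_of_real \<tau> \<cdot>\<^sub>m W) $$ (i, j)
          + (1 / (2 * complex_of_real (\<rho> * s))) * ((\<Xi> \<xi> - W) * (\<Xi> \<xi> + W)) $$ (i, j))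
          \<longlongrightarrow> (\<Xi> \<xi> - complex_of_real \<tau> \<cdot>\<^sub>m W) $$ (i, j) + 0 * ((\<Xi> \<xi> - W) * (\<Xi> \<xi> + W)) $$ (i, j)) at_top"
        by (intro tendsto_intros inv)
      moreover have "G s \<xi> $$ (i, j) = (\<Xi> \<xi> - complex_of_real \<tau> \<cdot>\<^sub>m W) $$ (i, j)
          + (1 / (2 * complex_of_real (\<rho> * s))) * ((\<Xi> \<xi> - W) * (\<Xi> \<xi> + W)) $$ (i, j)" for s
        using ij PQ unfolding G_def by (simp del: index_mult_mat)
      moreover have "(- char_matrix (H + complex_of_real \<tau> \<cdot>\<^sub>m W) \<xi>) $$ (i, j)
          = (\<Xi> \<xi> - complex_of_real \<tau> \<cdot>\<^sub>m W) $$ (i, j)"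
        using ij H W by (simp add: char_matrix_def \<Xi>_def)
      ultimately show "((\<lambda>s. G s \<xi> $$ (i, j)) \<longlongrightarrow> (- char_matrix (H + complex_of_real \<tau> \<cdot>\<^sub>m W) \<xi>) $$ (i, j)) at_top"
        by simp
    qed (use HW PQ in \<open>auto simp: G_def\<close>)
    moreover have "det (- char_matrix (H + complex_of_real \<tau> \<cdot>\<^sub>m W) \<xi>) = (\<Prod>i<n. \<xi> - u i)"
      using char_poly_matrix[OF HW, of \<xi>] u unfolding spectrum_family_def by (simp add: poly_prod)
    ultimately show ?thesis unfolding f_def by simp
  qed
  \<comment> \<open>The reference point at which the limit polynomial does not vanish.\<close>
  obtain u' where u': "u' \<notin> u ` {..<n}"
    using ex_new_if_finite[OF infinite_UNIV_char_0, of "u ` {..<n}"] by blast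
  have "\<forall>\<^sub>F s in at_top. \<exists>j<2 * n. cmod (y s j - complex_of_real (\<rho> * s) - u i) < \<delta>"
  proof (rule eventually_root_near[OF f_eq _ lim[of u']])
    show "((\<lambda>s. f s (u i)) \<longlongrightarrow> 0) at_top"
      using lim[of "u i"] \<open>i < n\<close> by (metis (mono_tags, lifting) eq_iff_diff_eq_0 finite_lessThan lessThan_iff prod_zero)
    show "(\<Prod>i<n. u' - u i) \<noteq> 0" using u' by auto
  qed (fact \<open>\<delta> > 0\<close>)
  then show ?thesis by (simp add: algebra_simps)
qed

text \<open>There are \<open>2 * n\<close> limit points, each attracting an eigenvalue, and for
  large \<open>s\<close> they are far enough apart to attract different ones. As there are only
  \<open>2 * n\<close> eigenvalues, this accounts for the whole spectrum.\<close>

lemma attach_spin_spectrum: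
  fixes a b \<rho> \<tau> :: real
  assumes H: "H \<in> carrier_mat n n" and W: "W \<in> carrier_mat n n"
    and \<rho>: "a\<^sup>2 + b\<^sup>2 = \<rho>\<^sup>2" "\<rho> > 0" "b = \<tau> * \<rho>"
    and u: "spectrum_family n (H + complex_of_real \<tau> \<cdot>\<^sub>m W) u" "inj_on u {..<n}"
    and v: "spectrum_family n (H + complex_of_real (- \<tau>) \<cdot>\<^sub>m W) v" "inj_on v {..<n}"
    and "\<delta> > 0"
  shows "\<forall>\<^sub>F s in at_top. \<exists>y.
     spectrum_family (2 * n) (attach_spin n (complex_of_real (a * s)) (complex_of_real (b * s)) W H) y \<and>
     (\<forall>i<2 * n. cmod (y i - ((if i < n then u i else v (i - n))
        + complex_of_real ((if i < n then \<rho> else - \<rho>) * s))) < \<delta>)"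
proof -
  let ?M = "\<lambda>s. attach_spin n (complex_of_real (a * s)) (complex_of_real (b * s)) W H"
  define z where "z i = (if i < n then u i else v (i - n))" for i
  define \<kappa> where "\<kappa> i = (if i < n then \<rho> else - \<rho>)" for i
  have "\<exists>y. spectrum_family (2 * n) (?M s) y" for s
    using spectrum_family_exists[OF attach_spin_carrier[OF H W]] by blast
  then obtain y where y: "\<And>s. spectrum_family (2 * n) (?M s) (y s)" by metis
  have "inj_on (\<lambda>i. (z i, \<kappa> i)) {..<2 * n}"
  proof (rule inj_onI)
    fix i j assume ij: "i \<in> {..<2 * n}" "j \<in> {..<2 * n}" "(z i, \<kappa> i) = (z j, \<kappa> j)"
    then have "i < n \<longleftrightarrow> j < n" using \<rho>(2) by (auto simp: \<kappa>_def split: if_splits)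
    moreover have "i - n = j - n" if "\<not> i < n" "\<not> j < n"
      using that ij inj_onD[OF v(2), of "i - n" "j - n"] by (auto simp: z_def)
    ultimately show "i = j"
      using ij inj_onD[OF u(2), of i j] by (cases "i < n") (auto simp: z_def)
  qed
  from eventually_inj_on_near_affine[OF finite_lessThan this]
  obtain \<delta>' where \<delta>': "\<delta>' > 0"
    and ev_inj: "\<forall>\<^sub>F s in at_top. \<forall>g. (\<forall>i\<in>{..<2 * n}. cmod (g i - (z i + complex_of_real (\<kappa> i * s))) < \<delta>')
      \<longrightarrow> inj_on g {..<2 * n}"
    by blast
  \<comment> \<open>Small enough both for the claimed precision and for the choice of eigenvalues to
    be injective.\<close>
  define \<epsilon> where "\<epsilon> = min \<delta> \<delta>'"
  have "\<epsilon> > 0" using \<delta>' \<open>\<delta> > 0\<close> by (simp add: \<epsilon>_def)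
  have "\<forall>\<^sub>F s in at_top. \<exists>j<2 * n. cmod (y s j - (z i + complex_of_real (\<kappa> i * s))) < \<epsilon>"
    if "i \<in> {..<2 * n}" for i
  proof (cases "i < n")
    case True
    then show ?thesis
      using attach_spin_eigenvalue_near[OF H W \<rho>(1) _ \<rho>(3) y u(1) True \<open>\<epsilon> > 0\<close>] \<rho>(2)
      by (simp add: z_def \<kappa>_def)
  next
    case False
    have "a\<^sup>2 + b\<^sup>2 = (- \<rho>)\<^sup>2" "- \<rho> \<noteq> 0" "b = (- \<tau>) * (- \<rho>)" "i - n < n"
      using \<rho> False that by auto
    from attach_spin_eigenvalue_near[OF H W this(1-3) y v(1) this(4) \<open>\<epsilon> > 0\<close>] show ?thesis
      using False by (simp add: z_def \<kappa>_def)
  qed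
  then have "\<forall>\<^sub>F s in at_top. \<forall>i\<in>{..<2 * n}. \<exists>j<2 * n. cmod (y s j - (z i + complex_of_real (\<kappa> i * s))) < \<epsilon>"
    by (intro eventually_ball_finite) auto
  then show ?thesis
    using ev_inj
  proof eventually_elim
    case (elim s)
    obtain p where p: "\<And>i. i < 2 * n \<Longrightarrow> p i < 2 * n"
      "\<And>i. i < 2 * n \<Longrightarrow> cmod (y s (p i) - (z i + complex_of_real (\<kappa> i * s))) < \<epsilon>"
      using elim(1) by (metis lessThan_iff)
    have "inj_on (\<lambda>i. y s (p i)) {..<2 * n}"
      using elim(2) p(2) by (simp add: \<epsilon>_def)
    then have "inj_on p {..<2 * n}"
      by (auto simp: inj_on_def)
    \<comment> \<open>An injective self-map of a finite set is a permutation, so relisting along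
      \<open>p\<close> preserves the spectrum.\<close>
    then have "bij_betw p {..<2 * n} {..<2 * n}"
      unfolding bij_betw_def using endo_inj_surj[of "{..<2 * n}" p] p(1) by auto
    then have "(\<Prod>i<2 * n. [:- y s (p i), 1:]) = (\<Prod>i<2 * n. [:- y s i, 1:])"
      by (rule prod.reindex_bij_betw)
    then have "spectrum_family (2 * n) (?M s) (\<lambda>i. y s (p i))"
      using y[of s] unfolding spectrum_family_def by simp
    moreover have "\<forall>i<2 * n. cmod (y s (p i) - (z i + complex_of_real (\<kappa> i * s))) < \<delta>"
      using p(2) by (auto simp: \<epsilon>_def)
    ultimately show ?case unfolding z_def \<kappa>_def by blast
  qed
qed

text \<open>The numbers come from \<open>12\<^sup>2 + 9\<^sup>2 = 15\<^sup>2\<close> and \<open>12\<^sup>2 + 16\<^sup>2 = 20\<^sup>2\<close>: the two fields share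
  their \<open>X\<close> component, have different sizes, and \<open>9 / 15 * 5 = 3\<close>, \<open>16 / 20 * 5 = 4\<close>.\<close>

lemma gap_det_attach_spin:
  fixes e :: real
  assumes H: "H \<in> carrier_mat n n" and V: "V \<in> carrier_mat n n"
    and sep: "\<And>k l. k \<in> {3, - 3, 4, - 4} \<Longrightarrow> l \<in> {3, - 3, 4, - 4} \<Longrightarrow> k \<noteq> l \<Longrightarrow>
      gap_det {k, l} n (\<lambda>k. H + complex_of_real (k * e) \<cdot>\<^sub>m V) \<noteq> 0"
  shows "\<exists>a > 0 :: real. gap_det {9, 16 :: real} (2 * n)
    (\<lambda>b. attach_spin n (complex_of_real (12 * a)) (complex_of_real (b * a)) (complex_of_real (5 * e) \<cdot>\<^sub>m V) H) \<noteq> 0"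
proof -
  define K :: "real set" where "K = {3, - 3, 4, - 4}"
  define B where "B k = H + complex_of_real (k * e) \<cdot>\<^sub>m V" for k
  have B: "B k \<in> carrier_mat n n" for k
    using H V by (simp add: B_def)
  have "\<exists>x. spectrum_family n (B k) x" for k
    using spectrum_family_exists[OF B] by blast
  then obtain x where x: "\<And>k. spectrum_family n (B k) (x k)" by metis
  have inj2: "inj_on (\<lambda>(k, i, j). x k i - x k j) (gap_index {k, l} n)" if "k \<in> K" "l \<in> K" "k \<noteq> l" for k l
    using sep[of k l] that gap_det_nonzero_iff[of "{k, l}" B n x] B x unfolding K_def B_def by blast
  have gaps: "k = l \<and> i = i' \<and> j = j'"
    if "k \<in> K" "l \<in> K" "i < n" "j < n" "i' < n" "j' < n" "i \<noteq> j" "i' \<noteq> j'" "x k i - x k j = x l i' - x l j'"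
    for k l i j i' j'
  proof -
    \<comment> \<open>The hypothesis concerns two distinct labels; if \<open>k = l\<close>, any
      other label can be the partner.\<close>
    obtain m where m: "m \<in> K" "m \<noteq> k" "l \<in> {k, m}"
    proof (cases "k = l")
      case True
      then show ?thesis using that[of 3] that[of 4] by (force simp: K_def)
    next
      case False
      then show ?thesis using that[of l] \<open>l \<in> K\<close> by blast
    qed
    show ?thesis
      using inj_onD[OF inj2[OF \<open>k \<in> K\<close> m(1) m(2)[symmetric]], of "(k, i, j)" "(l, i', j')"] that m
      by (auto simp: gap_index_def)
  qed
  \<comment> \<open>If two eigenvalues coincided, the gaps \<open>(i, j)\<close> and
    \<open>(j, i)\<close> would both be 0.\<close>
  have simple: "i = j" if "k \<in> K" "i < n" "j < n" "x k i = x k j" for k i j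
    using gaps[of k k i j j i] that by auto
  then have inj: "inj_on (x k) {..<n}" if "k \<in> K" for k
    using that by (auto intro: inj_onI)

  define S :: "real set" where "S = {9, 16}"
  \<comment> \<open>For \<open>b\<close> in \<open>S\<close>, \<open>R b\<close> is the field size
    per unit of \<open>s\<close> and \<open>T b = 5 * b / R b\<close> is the multiple of
    \<open>e\<close> with which the old chain feels \<open>V\<close>. \<open>sg i\<close> is the
    orientation of the new spin, \<open>ix i\<close> the number of the eigenvalue within that
    half.\<close>
  define R where "R b = (if b = 9 then 15 else 20 :: real)" for b :: real
  define T where "T b = (if b = 9 then 3 else 4 :: real)" for b :: real
  define sg where "sg i = (if i < n then 1 else - 1 :: real)" for i
  define ix where "ix i = (if i < n then i else i - n)" for i
  define z where "z b i = x (sg i * T b) (ix i)" for b i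
  define w where "w = (\<lambda>(b, i, j). z b i - z b j)"
  define \<kappa> where "\<kappa> = (\<lambda>(b, i, j). (sg i - sg j) * R b)"
  have TK: "sg i * T b \<in> K" if "b \<in> S" for b i
    using that by (auto simp: sg_def T_def K_def)
  have ix_less: "ix i < n" if "i < 2 * n" for i using that by (auto simp: ix_def)
  have index_eq: "i = j" if "sg i = sg j" "ix i = ix j" for i j
    using that by (auto simp: sg_def ix_def split: if_splits)
  have "inj_on (\<lambda>q. (w q, \<kappa> q)) (gap_index S (2 * n))"
  proof (rule inj_onI)
    fix q q' assume "q \<in> gap_index S (2 * n)" "q' \<in> gap_index S (2 * n)" and eq: "(w q, \<kappa> q) = (w q', \<kappa> q')"
    then obtain b i j b' i' j' where q: "q = (b, i, j)" "q' = (b', i', j')" and S: "b \<in> S" "b' \<in> S"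
      and less: "i < 2 * n" "j < 2 * n" "i' < 2 * n" "j' < 2 * n" and neq: "i \<noteq> j" "i' \<noteq> j'"
      unfolding gap_index_def by blast
    have eq_w: "x (sg i * T b) (ix i) - x (sg j * T b) (ix j)
        = x (sg i' * T b') (ix i') - x (sg j' * T b') (ix j')"
      and eq_\<kappa>: "(sg i - sg j) * R b = (sg i' - sg j') * R b'"
      using eq by (auto simp: q w_def \<kappa>_def z_def)
    note ixs = less[THEN ix_less]
    show "q = q'"
    \<comment> \<open>Gaps within one half of the spectrum have slope 0 and are gaps of the matrices
      \<open>B k\<close>. Gaps across the halves have slope plus or minus \<open>2 * R b\<close>,
      which determines \<open>b\<close> and both orientations.\<close>
    proof (cases "sg i = sg j")
      case True
      then have same: "sg i' = sg j'" using eq_\<kappa> by (auto simp: R_def split: if_splits)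
      have "ix i \<noteq> ix j" "ix i' \<noteq> ix j'" using True same neq index_eq by blast+
      then have *: "sg i * T b = sg i' * T b' \<and> ix i = ix i' \<and> ix j = ix j'"
        using gaps[OF TK TK, OF S ixs] eq_w True same by metis
      then have "b = b' \<and> sg i = sg i'"
        using S by (auto simp: T_def S_def sg_def split: if_splits)
      then show ?thesis using * True same index_eq unfolding q by metis
    next
      case False
      then have "b = b' \<and> sg i = sg i' \<and> sg j = sg j'"
        using eq_\<kappa> S by (auto simp: R_def S_def sg_def split: if_splits)
      then have b: "b = b'" and sgs: "sg i = sg i'" "sg j = sg j'" by auto
      have ne: "sg i * T b \<noteq> sg j * T b" using False by (auto simp: T_def split: if_splits)
      \<comment> \<open>Rearranged, an equality of gaps across the halves becomes an equality of
        gaps within them. These belong to two different labels, so both sides must be 0.\<close>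
      have eq': "x (sg i * T b) (ix i) - x (sg i * T b) (ix i') = x (sg j * T b) (ix j) - x (sg j * T b) (ix j')"
        using eq_w unfolding b[symmetric] sgs[symmetric] by (simp add: algebra_simps)
      have "ix i = ix i' \<and> ix j = ix j'"
      proof (cases "ix i = ix i'")
        case True
        then have "x (sg j * T b) (ix j) = x (sg j * T b) (ix j')" using eq' by simp
        then show ?thesis using True simple[OF TK[OF S(1)] ixs(2,4)] by simp
      next
        case False
        then have "ix j \<noteq> ix j'" using eq' simple[OF TK[OF S(1)] ixs(1,3)] by auto
        then show ?thesis
          using gaps[OF TK[OF S(1)] TK[OF S(1)] ixs(1,3,2,4) False _ eq'] ne by blast
      qed
      then show ?thesis using b sgs index_eq unfolding q by blast
    qed
  qed
  from eventually_inj_on_near_affine[OF finite_gap_index this]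
  obtain \<delta> where \<delta>: "\<delta> > 0"
    and ev_inj: "\<forall>\<^sub>F s in at_top. \<forall>g. (\<forall>q\<in>gap_index S (2 * n). cmod (g q - (w q + complex_of_real (\<kappa> q * s))) < \<delta>)
      \<longrightarrow> inj_on g (gap_index S (2 * n))"
    by (auto simp: S_def)
  let ?W = "complex_of_real (5 * e) \<cdot>\<^sub>m V"
  let ?M = "\<lambda>b s. attach_spin n (complex_of_real (12 * s)) (complex_of_real (b * s)) ?W H"
  have W: "?W \<in> carrier_mat n n" using V by simp
  \<comment> \<open>Precision \<open>\<delta> / 2\<close> for eigenvalues gives precision
    \<open>\<delta>\<close> for their differences.\<close>
  have "\<forall>\<^sub>F s in at_top. \<exists>y. spectrum_family (2 * n) (?M b s) y \<and>
      (\<forall>i<2 * n. cmod (y i - (z b i + complex_of_real (sg i * R b * s))) < \<delta> / 2)" if "b \<in> S" for b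
  proof -
    have "sg i * R b = (if i < n then R b else - R b)"
      "z b i = (if i < n then x (T b) i else x (- T b) (i - n))" for i
      by (auto simp: sg_def z_def ix_def)
    moreover have "(12 :: real)\<^sup>2 + b\<^sup>2 = (R b)\<^sup>2" "R b > 0" "b = (T b / 5) * R b"
      using that by (auto simp: S_def R_def T_def)
    moreover have "H + complex_of_real (t * (T b / 5)) \<cdot>\<^sub>m ?W = B (t * T b)" for t
      using H V by (intro eq_matI) (auto simp: B_def)
    from this[of 1] this[of "- 1"] have "H + complex_of_real (T b / 5) \<cdot>\<^sub>m ?W = B (T b)"
      "H + complex_of_real (- (T b / 5)) \<cdot>\<^sub>m ?W = B (- T b)" by simp_all
    moreover have "T b \<in> K" "- T b \<in> K" using that by (auto simp: S_def T_def K_def)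
    ultimately show ?thesis
      using attach_spin_spectrum[OF H W, of 12 b "R b" "T b / 5" "x (T b)" "x (- T b)" "\<delta> / 2"] \<delta> x inj
      by simp
  qed
  then have "\<forall>\<^sub>F s in at_top. \<forall>b\<in>S. \<exists>y. spectrum_family (2 * n) (?M b s) y \<and>
      (\<forall>i<2 * n. cmod (y i - (z b i + complex_of_real (sg i * R b * s))) < \<delta> / 2)"
    by (intro eventually_ball_finite) (auto simp: S_def)
  with ev_inj have "\<forall>\<^sub>F s in at_top. gap_det S (2 * n) (\<lambda>b. ?M b s) \<noteq> 0"
  proof eventually_elim
    case (elim s)
    obtain y where y: "\<And>b. b \<in> S \<Longrightarrow> spectrum_family (2 * n) (?M b s) (y b)"
      and near: "\<And>b i. b \<in> S \<Longrightarrow> i < 2 * n \<Longrightarrow> cmod (y b i - (z b i + complex_of_real (sg i * R b * s))) < \<delta> / 2"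
      using elim(2) by metis
    have "cmod ((\<lambda>(b, i, j). y b i - y b j) q - (w q + complex_of_real (\<kappa> q * s))) < \<delta>"
      if "q \<in> gap_index S (2 * n)" for q
    proof -
      obtain b i j where q: "q = (b, i, j)" "b \<in> S" "i < 2 * n" "j < 2 * n"
        using \<open>q \<in> _\<close> by (auto simp: gap_index_def)
      have "(\<lambda>(b, i, j). y b i - y b j) q - (w q + complex_of_real (\<kappa> q * s))
          = (y b i - (z b i + complex_of_real (sg i * R b * s))) - (y b j - (z b j + complex_of_real (sg j * R b * s)))"
        by (simp add: q(1) w_def \<kappa>_def algebra_simps)
      also have "cmod \<dots> < \<delta>"
        using norm_triangle_ineq4[of "y b i - (z b i + complex_of_real (sg i * R b * s))"
            "y b j - (z b j + complex_of_real (sg j * R b * s))"] near[OF q(2,3)] near[OF q(2,4)]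
        by linarith
      finally show ?thesis .
    qed
    then have "inj_on (\<lambda>(b, i, j). y b i - y b j) (gap_index S (2 * n))"
      using elim(1) by blast
    then show ?case
      using gap_det_nonzero_iff[of S "\<lambda>b. ?M b s" "2 * n" y] attach_spin_carrier[OF H W] y
      by (simp only: S_def finite.intros simp_thms)
  qed
  from eventually_conj[OF eventually_gt_at_top[of 0] this] show ?thesis
    unfolding S_def using eventually_happens'[OF trivial_limit_at_top_linorder] by blast
qed

lemma gap_det_reindex:
  assumes "inj_on \<phi> S"
  shows "gap_det (\<phi> ` S) n A = gap_det S n (\<lambda>s. A (\<phi> s))"
  unfolding gap_det_def by (simp add: card_image[OF assms] sum.reindex[OF assms] o_def)

text \<open>Injectivity passes to subsets, so separation for two fields yields separation for
  one.\<close>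

lemma gap_det_nonzero_subset:
  assumes "finite S" "T \<subseteq> S" "\<And>s. s \<in> S \<Longrightarrow> A s \<in> carrier_mat n n" "gap_det S n A \<noteq> 0"
  shows "gap_det T n A \<noteq> 0"
proof -
  have "\<exists>x. spectrum_family n (A s) x" if "s \<in> S" for s
    using spectrum_family_exists[OF assms(3)[OF that]] by blast
  then obtain x where x: "\<And>s. s \<in> S \<Longrightarrow> spectrum_family n (A s) (x s)" by metis
  have "gap_index T n \<subseteq> gap_index S n" using assms(2) by (auto simp: gap_index_def)
  moreover have "inj_on (\<lambda>(s, i, j). x s i - x s j) (gap_index S n)"
    using gap_det_nonzero_iff[of S A n x] assms x by blast
  ultimately have "inj_on (\<lambda>(s, i, j). x s i - x s j) (gap_index T n)"
    by (rule inj_on_subset[rotated])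
  moreover have "finite T" using assms(1,2) finite_subset by blast
  ultimately show ?thesis
    using gap_det_nonzero_iff[of T A n x] assms x by blast
qed

section \<open>Ising chains\<close>

text \<open>The value at \<open>0\<close> is a convention: it makes the one-dimensional, gapless empty chain
  the base case of the induction.\<close>

fun first_spin_z :: "nat \<Rightarrow> complex mat" where
  "first_spin_z 0 = 0\<^sub>m 1 1"
| "first_spin_z (Suc N) =
     four_block_mat (1\<^sub>m (2 ^ N)) (0\<^sub>m (2 ^ N) (2 ^ N)) (0\<^sub>m (2 ^ N) (2 ^ N)) (- 1\<^sub>m (2 ^ N))"

text \<open>The chain grows at the front: \<open>a 0\<close> and \<open>b 0\<close> are the fields
  at the first spin, \<open>c 0\<close> is its bond to the second. As \<open>first_spin_z 0\<close>
  is zero, the bond beyond the last spin vanishes.\<close>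

fun ising :: "nat \<Rightarrow> (nat \<Rightarrow> real) \<Rightarrow> (nat \<Rightarrow> real) \<Rightarrow> (nat \<Rightarrow> real) \<Rightarrow> complex mat" where
  "ising 0 a b c = 0\<^sub>m 1 1"
| "ising (Suc N) a b c =
     attach_spin (2 ^ N) (complex_of_real (a 0)) (complex_of_real (b 0))
       (complex_of_real (c 0) \<cdot>\<^sub>m first_spin_z N) (ising N (a \<circ> Suc) (b \<circ> Suc) (c \<circ> Suc))"

lemma first_spin_z_carrier: "first_spin_z N \<in> carrier_mat (2 ^ N) (2 ^ N)"
proof (cases N)
  case (Suc M)
  have "- 1\<^sub>m (2 ^ M) \<in> carrier_mat (2 ^ M) (2 ^ M)" by simp
  from four_block_carrier_mat[OF one_carrier_mat this] show ?thesis
    by (simp add: Suc mult_2)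
qed simp

lemma ising_carrier: "ising N a b c \<in> carrier_mat (2 ^ N) (2 ^ N)"
proof (induction N arbitrary: a b c)
  case (Suc N)
  then show ?case
    using attach_spin_carrier[OF Suc smult_carrier_mat[OF first_spin_z_carrier]] by simp
qed simp

lemma attach_spin_shift:
  assumes "H \<in> carrier_mat (2 ^ N) (2 ^ N)" "W \<in> carrier_mat (2 ^ N) (2 ^ N)"
  shows "attach_spin (2 ^ N) a (b + \<beta>) W H = attach_spin (2 ^ N) a b W H + \<beta> \<cdot>\<^sub>m first_spin_z (Suc N)"
  using assms by (intro eq_matI) (auto simp: attach_spin_def algebra_simps)

text \<open>Adding a multiple of the first \<open>Z\<close> only changes the first field, so the
  induction stays among Ising chains.\<close>

lemma ising_shift:
  "ising N a (b(0 := b 0 + \<beta>)) c = ising N a b c + complex_of_real \<beta> \<cdot>\<^sub>m first_spin_z N"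
proof (cases N)
  case (Suc M)
  have "b(0 := b 0 + \<beta>) \<circ> Suc = b \<circ> Suc" by (simp add: fun_eq_iff)
  then show ?thesis
    using Suc attach_spin_shift[OF ising_carrier smult_carrier_mat[OF first_spin_z_carrier]]
    by (simp del: first_spin_z.simps)
qed simp

text \<open>Two field values close the induction: genericity turns them into four values in the
  ratio required by \<open>gap_det_attach_spin\<close>, which returns two values for the longer
  chain.\<close>

lemma ising_gaps_separated:
  "\<exists>a b c \<beta> \<beta>'. \<beta> \<noteq> \<beta>' \<and>
     gap_det {\<beta>, \<beta>'} (2 ^ N) (\<lambda>\<beta>. ising N a b c + complex_of_real \<beta> \<cdot>\<^sub>m first_spin_z N) \<noteq> 0"
proof (induction N)
  case 0
  \<comment> \<open>A matrix of size 1 has no gaps, so this is the determinant of an empty matrix,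
    which is 1.\<close>
  have "gap_det {0, 1} (2 ^ 0) (\<lambda>\<beta>. ising 0 a b c + complex_of_real \<beta> \<cdot>\<^sub>m first_spin_z 0) \<noteq> 0" for a b c
    by (simp add: gap_det_def)
  then show ?case by (metis zero_neq_one)
next
  case (Suc N)
  let ?n = "2 ^ N :: nat" and ?Z = "first_spin_z N"
  note Z = first_spin_z_carrier[of N]
  obtain a b c \<beta> \<beta>' where neq: "\<beta> \<noteq> \<beta>'"
    and IH: "gap_det {\<beta>, \<beta>'} ?n (\<lambda>\<beta>. ising N a b c + complex_of_real \<beta> \<cdot>\<^sub>m ?Z) \<noteq> 0"
    using Suc.IH by blast
  define A where "A \<beta> = ising N a b c + complex_of_real \<beta> \<cdot>\<^sub>m ?Z" for \<beta>
  have A: "A \<beta> \<in> carrier_mat ?n ?n" for \<beta>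
    using ising_carrier[of N a b c] Z by (simp add: A_def)
  define K :: "real set" where "K = {3, - 3, 4, - 4}"
  \<comment> \<open>\<open>x 0\<close> shifts the first field and \<open>x 1\<close> is the unit
    \<open>e\<close> of \<open>gap_det_attach_spin\<close>.\<close>
  define F where "F = (\<lambda>(k, l) (x :: nat \<Rightarrow> real). gap_det {k, l} ?n (\<lambda>k. A (x 0 + k * x 1)))"
  have "\<exists>x. \<forall>p\<in>{(k, l) \<in> K \<times> K. k \<noteq> l}. F p x \<noteq> 0"
  proof (rule separately_polynomial_common_nonzero[where I = "{0, 1}"])
    show "finite {(k, l) \<in> K \<times> K. k \<noteq> l}"
      by (rule finite_subset[of _ "K \<times> K"]) (auto simp: K_def)
  next
    fix p assume "p \<in> {(k, l) \<in> K \<times> K. k \<noteq> l}"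
    then obtain k l where p: "p = (k, l)" "k \<noteq> l" by blast
    have entry: "separately_polynomial {0, 1} (\<lambda>x :: nat \<Rightarrow> real. A (x 0 + s * x 1) $$ (i, j))"
      if "i < ?n" "j < ?n" for s i j
    proof -
      have "(\<lambda>x :: nat \<Rightarrow> real. A (x 0 + s * x 1) $$ (i, j)) =
          (\<lambda>x. ising N a b c $$ (i, j)
            + (complex_of_real (x 0) + complex_of_real s * complex_of_real (x 1)) * ?Z $$ (i, j))"
        using that ising_carrier[of N a b c] Z by (simp add: A_def fun_eq_iff)
      then show ?thesis
        by (simp only:) (intro separately_polynomial_add separately_polynomial_mult
          separately_polynomial_const separately_polynomial_proj; simp)
    qed
    show "separately_polynomial {0, 1} (F p)"
      unfolding p F_def prod.case by (rule separately_polynomial_gap_det) (auto intro: A entry[unfolded One_nat_def])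
    \<comment> \<open>Chosen so that the affine map with offset \<open>x 0\<close> and slope
      \<open>x 1\<close> sends \<open>k\<close> and \<open>l\<close> to \<open>\<beta>\<close> and
      \<open>\<beta>'\<close>; then \<open>F p\<close> is nonzero by the induction hypothesis. The
      witness may depend on the pair.\<close>
    define d where "d = (\<beta> - \<beta>') / (k - l)"
    define x where "x = (\<lambda>i :: nat. if i = 0 then \<beta> - k * d else if i = 1 then d else undefined)"
    have "(k - l) * d = \<beta> - \<beta>'" using p(2) by (simp add: d_def)
    then have vals: "x 0 + k * x 1 = \<beta>" "x 0 + l * x 1 = \<beta>'"
      by (simp_all add: x_def algebra_simps)
    then have "inj_on (\<lambda>k. x 0 + k * x 1) {k, l}" using neq by (auto simp: inj_on_def)
    from gap_det_reindex[OF this, of ?n A] have "F p x \<noteq> 0"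
      using IH vals unfolding p F_def A_def by simp
    moreover have "x \<in> extensional {0, 1}" by (auto simp: x_def extensional_def)
    ultimately show "\<exists>x\<in>extensional {0, 1}. F p x \<noteq> 0" by blast
  qed simp
  then obtain x where x: "\<And>k l. k \<in> K \<Longrightarrow> l \<in> K \<Longrightarrow> k \<noteq> l \<Longrightarrow> F (k, l) x \<noteq> 0" by blast
  have "ising N a b c + complex_of_real (x 0 + k * x 1) \<cdot>\<^sub>m ?Z
      = A (x 0) + complex_of_real (k * x 1) \<cdot>\<^sub>m ?Z" for k
    using ising_carrier[of N a b c] Z by (intro eq_matI) (auto simp: A_def algebra_simps)
  then have "\<exists>s>0. gap_det {9, 16 :: real} (2 * ?n) (\<lambda>b. attach_spin ?n (complex_of_real (12 * s))
      (complex_of_real (b * s)) (complex_of_real (5 * x 1) \<cdot>\<^sub>m ?Z) (A (x 0))) \<noteq> 0"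
    using x by (intro gap_det_attach_spin[OF A Z]) (simp add: K_def F_def A_def)
  then obtain s where s: "s > 0" "gap_det {9, 16 :: real} (2 * ?n) (\<lambda>b. attach_spin ?n (complex_of_real (12 * s))
      (complex_of_real (b * s)) (complex_of_real (5 * x 1) \<cdot>\<^sub>m ?Z) (A (x 0))) \<noteq> 0" by blast
  \<comment> \<open>The new spin starts with \<open>Z\<close> field 0, later shifted to
    \<open>9 * s\<close> or \<open>16 * s\<close>. The offset \<open>x 0\<close> goes into the
    \<open>Z\<close> field of the old first spin.\<close>
  define a' where "a' = case_nat (12 * s) a"
  define b' where "b' = case_nat 0 (b(0 := b 0 + x 0))"
  define c' where "c' = case_nat (5 * x 1) c"
  have comp: "a' \<circ> Suc = a" "b' \<circ> Suc = b(0 := b 0 + x 0)" "c' \<circ> Suc = c"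
    by (auto simp: a'_def b'_def c'_def fun_eq_iff)
  have ising_Suc: "ising (Suc N) a' b' c' =
      attach_spin ?n (complex_of_real (12 * s)) 0 (complex_of_real (5 * x 1) \<cdot>\<^sub>m ?Z) (A (x 0))"
    unfolding ising.simps comp ising_shift A_def by (simp add: a'_def b'_def c'_def)
  have "attach_spin ?n (complex_of_real (12 * s)) (complex_of_real (t * s))
      (complex_of_real (5 * x 1) \<cdot>\<^sub>m ?Z) (A (x 0))
      = ising (Suc N) a' b' c' + complex_of_real (t * s) \<cdot>\<^sub>m first_spin_z (Suc N)" for t
    unfolding ising_Suc
    using attach_spin_shift[OF A smult_carrier_mat[OF Z], where b = 0 and \<beta> = "complex_of_real (t * s)"]
    by (simp only: add_0_left)
  then have "gap_det {9, 16 :: real} (2 ^ Suc N)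
      (\<lambda>t. ising (Suc N) a' b' c' + complex_of_real (t * s) \<cdot>\<^sub>m first_spin_z (Suc N)) \<noteq> 0"
    using s(2) by (simp del: first_spin_z.simps ising.simps)
  then have "gap_det {9 * s, 16 * s} (2 ^ Suc N)
      (\<lambda>\<beta>. ising (Suc N) a' b' c' + complex_of_real \<beta> \<cdot>\<^sub>m first_spin_z (Suc N)) \<noteq> 0"
    using gap_det_reindex[of "\<lambda>t. t * s" "{9, 16}"] s(1) by (simp add: inj_on_def del: first_spin_z.simps ising.simps)
  moreover have "9 * s \<noteq> 16 * s" using s(1) by simp
  ultimately show ?case by blast
qed

section \<open>Pauli operators as block matrices\<close>

lemma kronecker_four_block:
  assumes "A \<in> carrier_mat 2 2" "B \<in> carrier_mat n n"
  shows "kronecker A B = four_block_mat (A $$ (0, 0) \<cdot>\<^sub>m B) (A $$ (0, 1) \<cdot>\<^sub>m B)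
    (A $$ (1, 0) \<cdot>\<^sub>m B) (A $$ (1, 1) \<cdot>\<^sub>m B)"
proof (rule eq_matI)
  fix i j assume "i < dim_row (four_block_mat (A $$ (0, 0) \<cdot>\<^sub>m B) (A $$ (0, 1) \<cdot>\<^sub>m B)
      (A $$ (1, 0) \<cdot>\<^sub>m B) (A $$ (1, 1) \<cdot>\<^sub>m B))"
    "j < dim_col (four_block_mat (A $$ (0, 0) \<cdot>\<^sub>m B) (A $$ (0, 1) \<cdot>\<^sub>m B)
      (A $$ (1, 0) \<cdot>\<^sub>m B) (A $$ (1, 1) \<cdot>\<^sub>m B))"
  then have ij: "i < 2 * n" "j < 2 * n" using assms by auto
  have divmod: "k div n = (if k < n then 0 else 1) \<and> k mod n = (if k < n then k else k - n)" if "k < 2 * n" for k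
    using that by (auto simp: div_if mod_if)
  show "kronecker A B $$ (i, j) = four_block_mat (A $$ (0, 0) \<cdot>\<^sub>m B) (A $$ (0, 1) \<cdot>\<^sub>m B)
      (A $$ (1, 0) \<cdot>\<^sub>m B) (A $$ (1, 1) \<cdot>\<^sub>m B) $$ (i, j)"
    using ij assms divmod[OF ij(1)] divmod[OF ij(2)] by (auto simp: kronecker_def)
qed (use assms in \<open>auto simp: kronecker_def\<close>)

lemma tensor_factors_Suc:
  "tensor_factors (Suc N) M = kronecker (M 1) (tensor_factors N (\<lambda>i. M (Suc i)))"
proof -
  \<comment> \<open>Sites are numbered from 1, so removing the first factor shifts the others down
    by one.\<close>
  have "[1..<Suc (Suc N)] = 1 # map Suc [1..<Suc N]"
    by (simp add: map_Suc_upt upt_conv_Cons del: upt_Suc)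
  then show ?thesis
    unfolding tensor_factors_def by (simp add: o_def del: upt_Suc)
qed

lemma pauli_carrier: "pauli k \<in> carrier_mat 2 2"
  by (cases k) (auto simp: mat_of_rows_list_def)

lemma tensor_factors_one: "tensor_factors N (\<lambda>i. 1\<^sub>m 2) = 1\<^sub>m (2 ^ N)"
proof (induction N)
  case (Suc N)
  then show ?case
    unfolding tensor_factors_Suc
    by (subst kronecker_four_block[where n = "2 ^ N"]) (auto intro!: eq_matI)
qed (simp add: tensor_factors_def)

lemma site_pauli_first:
  "site_pauli (Suc N) 1 k = kronecker (pauli k) (1\<^sub>m (2 ^ N))"
  unfolding site_pauli_def tensor_factors_Suc tensor_factors_one[symmetric]
  by (auto simp: tensor_factors_def intro!: arg_cong[where f = "kronecker _"] foldr_cong map_cong)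

lemma site_pauli_first_X:
  "site_pauli (Suc N) (Suc 0) X = four_block_mat (0\<^sub>m (2 ^ N) (2 ^ N)) (1\<^sub>m (2 ^ N)) (1\<^sub>m (2 ^ N)) (0\<^sub>m (2 ^ N) (2 ^ N))"
  unfolding One_nat_def[symmetric] site_pauli_first kronecker_four_block[OF pauli_carrier one_carrier_mat]
  by (intro cong_four_block_mat eq_matI) (auto simp: mat_of_rows_list_def)

lemma site_pauli_first_Z:
  "site_pauli (Suc N) (Suc 0) Z = first_spin_z (Suc N)"
  unfolding One_nat_def[symmetric] site_pauli_first kronecker_four_block[OF pauli_carrier one_carrier_mat] first_spin_z.simps
  by (intro cong_four_block_mat eq_matI) (auto simp: mat_of_rows_list_def)

lemma site_pauli_later:
  "site_pauli (Suc N) (Suc (Suc i)) k =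
    four_block_mat (site_pauli N (Suc i) k) (0\<^sub>m (2 ^ N) (2 ^ N)) (0\<^sub>m (2 ^ N) (2 ^ N)) (site_pauli N (Suc i) k)"
proof -
  have "site_pauli (Suc N) (Suc (Suc i)) k = kronecker (1\<^sub>m 2) (site_pauli N (Suc i) k)"
    unfolding site_pauli_def tensor_factors_Suc by simp
  also have "\<dots> = four_block_mat (site_pauli N (Suc i) k) (0\<^sub>m (2 ^ N) (2 ^ N)) (0\<^sub>m (2 ^ N) (2 ^ N)) (site_pauli N (Suc i) k)"
    unfolding kronecker_four_block[OF one_carrier_mat site_pauli_carrier]
    using site_pauli_carrier[of N "Suc i" k] by (intro cong_four_block_mat eq_matI) auto
  finally show ?thesis .
qed

lemma bond_later:
  "site_pauli (Suc N) (Suc (Suc i)) k * site_pauli (Suc N) (Suc (Suc j)) l =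
    four_block_mat (site_pauli N (Suc i) k * site_pauli N (Suc j) l) (0\<^sub>m (2 ^ N) (2 ^ N))
      (0\<^sub>m (2 ^ N) (2 ^ N)) (site_pauli N (Suc i) k * site_pauli N (Suc j) l)"
  unfolding site_pauli_later
  by (subst mult_four_block_mat[where ?nr1.0 = "2 ^ N" and ?nr2.0 = "2 ^ N" and ?n1.0 = "2 ^ N" and ?n2.0 = "2 ^ N"
        and ?nc1.0 = "2 ^ N" and ?nc2.0 = "2 ^ N"])
     (use site_pauli_carrier[of N "Suc i" k] site_pauli_carrier[of N "Suc j" l] in auto)

text \<open>The first \<open>Z\<close> puts opposite signs on the two diagonal blocks: this is how
  the coupling \<open>W\<close> enters \<open>attach_spin\<close>.\<close>

lemma bond_first:
  "first_spin_z (Suc (Suc N)) * site_pauli (Suc (Suc N)) (Suc (Suc 0)) Z =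
    four_block_mat (first_spin_z (Suc N)) (0\<^sub>m (2 ^ Suc N) (2 ^ Suc N))
      (0\<^sub>m (2 ^ Suc N) (2 ^ Suc N)) (- first_spin_z (Suc N))"
  unfolding site_pauli_later site_pauli_first_Z first_spin_z.simps(2)[of "Suc N"]
  by (subst mult_four_block_mat[where ?nr1.0 = "2 ^ Suc N" and ?nr2.0 = "2 ^ Suc N" and ?n1.0 = "2 ^ Suc N"
        and ?n2.0 = "2 ^ Suc N" and ?nc1.0 = "2 ^ Suc N" and ?nc2.0 = "2 ^ Suc N"])
     (use first_spin_z_carrier[of "Suc N"] in \<open>auto simp del: first_spin_z.simps\<close>)

text \<open>Induction by removing the first spin. Terms on later sites are two diagonal copies of
  those of the shorter chain; the first spin's fields and bond give the remaining parts of
  \<open>attach_spin\<close>.\<close>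

lemma ising_eq_sum:
  assumes "r < 2 ^ N" "s < 2 ^ N"
  shows "ising N a b c $$ (r, s) =
    (\<Sum>i<N. complex_of_real (a i) * site_pauli N (Suc i) X $$ (r, s) + complex_of_real (b i) * site_pauli N (Suc i) Z $$ (r, s))
    + (\<Sum>i<N - 1. complex_of_real (c i) * (site_pauli N (Suc i) Z * site_pauli N (Suc (Suc i)) Z) $$ (r, s))"
  using assms
proof (induction N arbitrary: a b c r s)
  case (Suc N)
  let ?n = "2 ^ N :: nat"
  note car = site_pauli_carrier[of N] first_spin_z_carrier[of N] ising_carrier[of N "a \<circ> Suc" "b \<circ> Suc" "c \<circ> Suc"]
  have dims: "dim_row (site_pauli N i k) = ?n" "dim_col (site_pauli N i k) = ?n"
    "dim_row (first_spin_z N) = ?n" "dim_col (first_spin_z N) = ?n" 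
    "dim_row (ising N a b c) = ?n" "dim_col (ising N a b c) = ?n" for i k a b c
    using site_pauli_carrier[of N i k] first_spin_z_carrier[of N] ising_carrier[of N a b c] by auto
  define blk where "blk D = four_block_mat D (0\<^sub>m ?n ?n) (0\<^sub>m ?n ?n) D" for D :: "complex mat"
  define H where "H = ising N (a \<circ> Suc) (b \<circ> Suc) (c \<circ> Suc)"
  have blk: "blk D $$ (r, s) = (if r < ?n \<longleftrightarrow> s < ?n then D $$ (r mod ?n, s mod ?n) else 0)"
    if "D \<in> carrier_mat ?n ?n" for D
    using that Suc.prems by (auto simp: blk_def mod_if)
  have mods: "r mod ?n < ?n" "s mod ?n < ?n" by simp_all
  have H: "blk H $$ (r, s) =
    (\<Sum>i<N. complex_of_real (a (Suc i)) * blk (site_pauli N (Suc i) X) $$ (r, s)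
       + complex_of_real (b (Suc i)) * blk (site_pauli N (Suc i) Z) $$ (r, s))
    + (\<Sum>i<N - 1. complex_of_real (c (Suc i)) * blk (site_pauli N (Suc i) Z * site_pauli N (Suc (Suc i)) Z) $$ (r, s))"
    using car unfolding H_def
    by (simp add: blk mult_carrier_mat[OF site_pauli_carrier site_pauli_carrier] Suc.IH[OF mods]
        del: index_mult_mat)
  have bonds: "(\<Sum>i<N. complex_of_real (c i) * (site_pauli (Suc N) (Suc i) Z * site_pauli (Suc N) (Suc (Suc i)) Z) $$ (r, s))
      = complex_of_real (c 0) * four_block_mat (first_spin_z N) (0\<^sub>m ?n ?n) (0\<^sub>m ?n ?n) (- first_spin_z N) $$ (r, s)
      + (\<Sum>i<N - 1. complex_of_real (c (Suc i)) * blk (site_pauli N (Suc i) Z * site_pauli N (Suc (Suc i)) Z) $$ (r, s))"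
  \<comment> \<open>For \<open>N = 0\<close> there is no bond, in agreement with the zero matrix
    \<open>first_spin_z 0\<close>.\<close>
  proof (cases N)
    case 0
    then show ?thesis using Suc.prems by (auto dest!: less_2_cases)
  next
    case (Suc M)
    have "(\<Sum>i<N. complex_of_real (c i) * (site_pauli (Suc N) (Suc i) Z * site_pauli (Suc N) (Suc (Suc i)) Z) $$ (r, s))
      = complex_of_real (c 0) * (site_pauli (Suc N) (Suc 0) Z * site_pauli (Suc N) (Suc (Suc 0)) Z) $$ (r, s)
      + (\<Sum>i<M. complex_of_real (c (Suc i)) * (site_pauli (Suc N) (Suc (Suc i)) Z * site_pauli (Suc N) (Suc (Suc (Suc i))) Z) $$ (r, s))"
      unfolding Suc by (rule sum.lessThan_Suc_shift)
    also have "site_pauli (Suc N) (Suc 0) Z * site_pauli (Suc N) (Suc (Suc 0)) Z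
        = four_block_mat (first_spin_z N) (0\<^sub>m ?n ?n) (0\<^sub>m ?n ?n) (- first_spin_z N)"
      unfolding site_pauli_first_Z Suc by (rule bond_first)
    finally show ?thesis
      unfolding bond_later blk_def by (simp add: Suc del: index_mult_mat index_mat_four_block first_spin_z.simps power_Suc)
  qed
  have "(\<Sum>i<Suc N. complex_of_real (a i) * site_pauli (Suc N) (Suc i) X $$ (r, s)
        + complex_of_real (b i) * site_pauli (Suc N) (Suc i) Z $$ (r, s))
      + (\<Sum>i<Suc N - 1. complex_of_real (c i) * (site_pauli (Suc N) (Suc i) Z * site_pauli (Suc N) (Suc (Suc i)) Z) $$ (r, s))
    = complex_of_real (a 0) * site_pauli (Suc N) (Suc 0) X $$ (r, s)
        + complex_of_real (b 0) * site_pauli (Suc N) (Suc 0) Z $$ (r, s)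
        + complex_of_real (c 0) * four_block_mat (first_spin_z N) (0\<^sub>m ?n ?n) (0\<^sub>m ?n ?n) (- first_spin_z N) $$ (r, s)
        + blk H $$ (r, s)"
    unfolding sum.lessThan_Suc_shift diff_Suc_1 bonds
    unfolding H
    unfolding site_pauli_later blk_def
    by (simp only: ac_simps)
  also have "\<dots> = ising (Suc N) a b c $$ (r, s)"
    using Suc.prems dims H_def unfolding site_pauli_first_X site_pauli_first_Z
    by (auto simp: attach_spin_def blk_def algebra_simps)
  finally show ?case by simp
qed simp

section \<open>Ising chains inside the full Hamiltonian\<close>

lemma sum_axis: "(\<Sum>k\<in>{X, Y, Z}. f k) = f X + f Y + (f Z :: 'a :: comm_monoid_add)"
  by (simp add: add.assoc)

lemma hamiltonian_entry:
  assumes "r < 2 ^ N" "s < 2 ^ N"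
  shows "hamiltonian N J \<alpha> $$ (r, s) =
    (\<Sum>(j, k)\<in>{1..N} \<times> {X, Y, Z}.
       complex_of_real (J (Single k)) * complex_of_real (\<alpha> (Site j k)) * site_pauli N j k $$ (r, s)) +
    (\<Sum>(j, k, l)\<in>{1..N - 1} \<times> {X, Y, Z} \<times> {X, Y, Z}.
       complex_of_real (J (Pair k l)) * complex_of_real (\<alpha> (Bond j k l)) *
         (site_pauli N j k * site_pauli N (j + 1) l) $$ (r, s))"
proof -
  have "(site_pauli N i k) \<in> carrier_mat (2 ^ N) (2 ^ N)" for i k by (rule site_pauli_carrier)
  then have dims: "dim_row (site_pauli N i k) = 2 ^ N" "dim_col (site_pauli N i k) = 2 ^ N" for i k by auto
  show ?thesis
    using assms unfolding hamiltonian_def mat_sum_def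
    by (simp add: case_prod_unfold dims del: index_mult_mat(1))
qed

text \<open>Dividing by the couplings makes the products \<open>J * \<alpha>\<close> the prescribed
  fields and bonds. The values may leave [-1, 1], which is harmless: a polynomial that is nonzero
  anywhere is nonzero almost everywhere in the cube.\<close>

definition ising_coeffs :: "nat \<Rightarrow> (coupling \<Rightarrow> real) \<Rightarrow> (nat \<Rightarrow> real) \<Rightarrow> (nat \<Rightarrow> real) \<Rightarrow> (nat \<Rightarrow> real) \<Rightarrow> coeff \<Rightarrow> real" where
  "ising_coeffs N J a b c = restrict (\<lambda>q. case q of
       Site j k \<Rightarrow> (case k of X \<Rightarrow> a (j - 1) / J (Single X) | Y \<Rightarrow> 0 | Z \<Rightarrow> b (j - 1) / J (Single Z))
     | Bond j k l \<Rightarrow> if k = Z \<and> l = Z then c (j - 1) / J (Pair Z Z) else 0) (coeff_index N)"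

lemma hamiltonian_ising_coeffs:
  assumes "J (Single X) \<noteq> 0" "J (Single Z) \<noteq> 0" "J (Pair Z Z) \<noteq> 0"
  shows "hamiltonian N J (ising_coeffs N J a b c) = ising N a b c"
proof (rule eq_matI)
  fix r s assume "r < dim_row (ising N a b c)" "s < dim_col (ising N a b c)"
  then have rs: "r < 2 ^ N" "s < 2 ^ N" using ising_carrier[of N a b c] by auto
  have site: "ising_coeffs N J a b c (Site (Suc i) k) =
      (case k of X \<Rightarrow> a i / J (Single X) | Y \<Rightarrow> 0 | Z \<Rightarrow> b i / J (Single Z))" if "i < N" for i k
    using that by (simp add: ising_coeffs_def coeff_index_def)
  have bond: "ising_coeffs N J a b c (Bond (Suc i) k l) =
      (if k = Z \<and> l = Z then c i / J (Pair Z Z) else 0)" if "i < N - 1" for i k l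
    using that by (simp add: ising_coeffs_def coeff_index_def)
  show "hamiltonian N J (ising_coeffs N J a b c) $$ (r, s) = ising N a b c $$ (r, s)"
    unfolding hamiltonian_entry[OF rs] ising_eq_sum[OF rs] sum.cartesian_product[symmetric]
      One_nat_def sum.atLeast1_atMost_eq sum_axis
    by (intro arg_cong2[where f = "(+)"] sum.cong refl) (use assms in \<open>simp_all add: site bond\<close>)
qed (use ising_carrier[of N a b c] hamiltonian_carrier[of N] in auto)

lemma separately_polynomial_hamiltonian_entry:
  assumes "r < 2 ^ N" "s < 2 ^ N"
  shows "separately_polynomial (coeff_index N) (\<lambda>\<alpha>. hamiltonian N J \<alpha> $$ (r, s))"
  unfolding hamiltonian_entry[OF assms] case_prod_unfold
  by (intro separately_polynomial_add separately_polynomial_sum separately_polynomial_mult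
      separately_polynomial_const separately_polynomial_proj)
     (auto simp: coeff_index_def)

lemma nondegenerate_gaps_gap_det:
  assumes A: "A \<in> carrier_mat n n" and "gap_det {()} n (\<lambda>_. A) \<noteq> 0"
  shows "nondegenerate_gaps A"
proof -
  obtain x where x: "spectrum_family n A x" by (rule spectrum_family_exists[OF A])
  have "inj_on (\<lambda>(u :: unit, i, j). x i - x j) (gap_index {()} n)"
    using gap_det_nonzero_iff[of "{()}" "\<lambda>_. A" n "\<lambda>_. x"] assms x by simp
  then have inj: "i = i' \<and> j = j'"
    if "i < n" "j < n" "i \<noteq> j" "i' < n" "j' < n" "i' \<noteq> j'" "x i - x j = x i' - x j'" for i j i' j'
    using that inj_onD[of "\<lambda>(u :: unit, i, j). x i - x j" "gap_index {()} n" "((), i, j)" "((), i', j')"]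
    by (simp add: gap_index_def)
  have "nondegenerate_gaps_list (map x [0..<n])"
    unfolding nondegenerate_gaps_list_inj_on
  proof (rule inj_onI)
    fix p q
    assume "p \<in> {(j, k). j < length (map x [0..<n]) \<and> k < length (map x [0..<n]) \<and> j \<noteq> k}"
      "q \<in> {(j, k). j < length (map x [0..<n]) \<and> k < length (map x [0..<n]) \<and> j \<noteq> k}"
      and eq: "(\<lambda>(j, k). map x [0..<n] ! j - map x [0..<n] ! k) p = (\<lambda>(j, k). map x [0..<n] ! j - map x [0..<n] ! k) q"
    then obtain i j i' j' where "p = (i, j)" "q = (i', j')" "i < n" "j < n" "i \<noteq> j" "i' < n" "j' < n" "i' \<noteq> j'"
      by auto
    then show "p = q" using inj[of i j i' j'] eq by simp
  qed
  then show ?thesis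
    unfolding nondegenerate_gaps_def using x spectrum_family_iff_lists_spectrum by blast
qed

theorem theorem2:
  fixes N :: nat and J :: "coupling \<Rightarrow> real"
  assumes "N \<ge> 1"
    and "J \<in> coupling_region"
  shows "{\<alpha> \<in> coeff_cube N. \<not> nondegenerate_gaps (hamiltonian N J \<alpha>)}
           \<in> null_sets (completion (\<Pi>\<^sub>M i\<in>coeff_index N. lborel))"
proof -
  let ?M = "\<Pi>\<^sub>M i\<in>coeff_index N. (lborel :: real measure)"
  define D where "D \<alpha> = gap_det {()} (2 ^ N) (\<lambda>_. hamiltonian N J \<alpha>)" for \<alpha>
  have pol: "separately_polynomial (coeff_index N) D"
    unfolding D_def
    by (rule separately_polynomial_gap_det) (auto intro: hamiltonian_carrier separately_polynomial_hamiltonian_entry)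
  obtain a b c \<beta> \<beta>' where
    "gap_det {\<beta>, \<beta>'} (2 ^ N) (\<lambda>\<beta>. ising N a b c + complex_of_real \<beta> \<cdot>\<^sub>m first_spin_z N) \<noteq> 0"
    using ising_gaps_separated[of N] by blast
  \<comment> \<open>Only one of the two fields is kept; it is then absorbed into the first
    \<open>Z\<close> field of the chain.\<close>
  then have "gap_det {\<beta>} (2 ^ N) (\<lambda>\<beta>. ising N a b c + complex_of_real \<beta> \<cdot>\<^sub>m first_spin_z N) \<noteq> 0"
    by (rule gap_det_nonzero_subset[rotated 3]) (auto intro: add_carrier_mat smult_carrier_mat first_spin_z_carrier)
  then have "gap_det {()} (2 ^ N) (\<lambda>_. ising N a (b(0 := b 0 + \<beta>)) c) \<noteq> 0"
    using gap_det_reindex[of "\<lambda>_ :: unit. \<beta>" "{()}"] unfolding ising_shift by simp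
  moreover have "J (Single X) \<noteq> 0" "J (Single Z) \<noteq> 0" "J (Pair Z Z) \<noteq> 0"
    using assms(2) by (auto simp: coupling_region_def)
  ultimately have nz: "D (ising_coeffs N J a (b(0 := b 0 + \<beta>)) c) \<noteq> 0"
    unfolding D_def by (simp add: hamiltonian_ising_coeffs)
  have "ising_coeffs N J a (b(0 := b 0 + \<beta>)) c \<in> space ?M"
    by (simp add: space_PiM ising_coeffs_def)
  from AE_separately_polynomial_nonzero[where F = D, OF finite_coeff_index pol this nz]
  have "AE \<alpha> in ?M. D \<alpha> \<noteq> 0" .
  moreover have "D \<in> borel_measurable ?M"
    using pol unfolding separately_polynomial_def by blast
  ultimately have "{\<alpha> \<in> space ?M. D \<alpha> = 0} \<in> null_sets ?M"
    by (subst (asm) AE_iff_null) auto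
  \<comment> \<open>An inclusion into a null set suffices, because the completed measure makes every
    subset of a null set null.\<close>
  moreover have "{\<alpha> \<in> coeff_cube N. \<not> nondegenerate_gaps (hamiltonian N J \<alpha>)} \<subseteq> {\<alpha> \<in> space ?M. D \<alpha> = 0}"
    using nondegenerate_gaps_gap_det[OF hamiltonian_carrier]
    unfolding D_def by (auto simp: coeff_cube_def space_PiM PiE_def)
  ultimately show ?thesis
    by (blast intro: null_sets_completion_subset null_sets_completionI)
qed

end
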